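(* For any $n\ge0$, $f_n\in\mathrm{Osc}_1(S_n)$ and $N\ge1$, $$N\,|\mathbb E(\eta_n^N(f_n))-\eta_n(f_n)|\le\sigma_{1,n},\qquad \sigma_{1,n}:=4\sum_{p=0}^nq_{p,n}^3\beta(\mathcal P_{p,n}).$$ Moreover, for any $m\ge1$, $$\sqrt N\,\mathbb E\big(|[\eta_n^N-\eta_n](f_n)|^m\big)^{1/m}\le\frac{1}{\sqrt N}b(2m)^2\sigma_{1,n}+b(m)\sigma_{2,n},\qquad \sigma_{2,n}:=2\sum_{p=0}^nq_{p,n}\beta(\mathcal P_{p,n}).$$
   Context: Let $(S_n)_{n\ge0}$ be measurable spaces, $\eta_0\in\mathcal P(S_0)$, $\mathcal M_n$ ($n\ge1$) Markov kernels from $S_{n-1}$ to $S_n$, and $\mathcal G_n:S_n\to(0,1)$ ($n\ge0$) measurable with $q_n:=\sup_{x,y}\mathcal G_n(x)/\mathcal G_n(y)<\infty$. Limiting flow: $\eta_{n+1}:=\Psi_n(\eta_n)\mathcal M_{n+1}$ with $\Psi_n(\mu)(dx):=\mathcal G_n(x)\mu(dx)/\mu(\mathcal G_n)$. Let $\mathcal Q_{p+1}(x,dy):=\mathcal G_p(x)\mathcal M_{p+1}(x,dy)$, $\mathcal Q_{p,n}:=\mathcal Q_{p+1}\cdots\mathcal Q_n$ ($\mathcal Q_{n,n}=\mathrm{Id}$), $\mathcal P_{p,n}(f):=\mathcal Q_{p,n}(f)/\mathcal Q_{p,n}(1)$, $q_{p,n}:=\sup_{x,y\in S_p}\mathcal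 Q_{p,n}(1)(x)/\mathcal Q_{p,n}(1)(y)$, $\beta(\mathcal P_{p,n}):=\sup_{f\in\mathrm{Osc}_1(S_n)}\mathrm{osc}(\mathcal P_{p,n}f)$, where $\mathrm{osc}(f)=\sup_{x,y}|f(x)-f(y)|$ and $\mathrm{Osc}_1(E)$ is the set of measurable functions on $E$ with oscillation at most $1$. Particle system: for $\mu\in\mathcal P(S_n)$, $\mathcal S_{n,\mu}(x,dy):=\mathcal G_n(x)\delta_x(dy)+(1-\mathcal G_n(x))\mathcal G_n(y)\mu(dy)/\mu(\mathcal G_n)$, $\mathcal K_{n+1,\mu}:=\mathcal S_{n,\mu}\mathcal M_{n+1}$; $\mathcal X_0^{(N,i)}$ i.i.d. $\eta_0$, and given $\mathcal X_n^{(N)}$ the $\mathcal X_{n+1}^{(N,i)}$ are conditionally independent with laws $\mathcal K_{n+1,\eta_n^N}(\mathcal X_n^{(N,i)},\cdot)$, $\eta_n^N:=\frac1N\sum_i\delta_{\mathcal X_n^{(N,i)}}$. Constants: $b(2m)^{2m}:=(2m)_m2^{-m}$, $b(2m+1)^{2m+1}:=\frac{(2m+1)_{(m+1)}}{\sqrt{m+1/2}}2^{-(m+1/2)}$, $(n)_k:=n!/(n-k)!$. *)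

theory Defs
  imports "HOL-Probability.Probability"
begin

text \<open>All state spaces S n are measurable spaces on one common carrier type 'a
  (S n :: 'a measure, only space and sets are used).  Markov kernels are
  measurable maps into the Giry monad (prob_algebra).\<close>

definition emp :: "'a measure \<Rightarrow> nat \<Rightarrow> (nat \<Rightarrow> 'a) \<Rightarrow> 'a measure" where
  "emp S N x = measure_of (space S) (sets S)
     (\<lambda>A. ennreal (real (card {i\<in>{..<N}. x i \<in> A}) / real N))"

definition Psi :: "('a \<Rightarrow> real) \<Rightarrow> 'a measure \<Rightarrow> 'a measure" where
  "Psi G \<mu> = density \<mu> (\<lambda>x. ennreal (G x / (\<integral>y. G y \<partial>\<mu>)))"

definition Sel :: "('a \<Rightarrow> real) \<Rightarrow> 'a measure \<Rightarrow> 'a \<Rightarrow> 'a measure" where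
  "Sel G \<mu> x = measure_of (space \<mu>) (sets \<mu>)
     (\<lambda>A. ennreal (G x) * indicator A x + ennreal (1 - G x) * emeasure (Psi G \<mu>) A)"

definition Kmu :: "('a \<Rightarrow> real) \<Rightarrow> ('a \<Rightarrow> 'a measure) \<Rightarrow> 'a measure \<Rightarrow> 'a \<Rightarrow> 'a measure" where
  "Kmu G M' \<mu> x = Sel G \<mu> x \<bind> M'"

fun eta :: "'a measure \<Rightarrow> (nat \<Rightarrow> 'a \<Rightarrow> 'a measure) \<Rightarrow> (nat \<Rightarrow> 'a \<Rightarrow> real) \<Rightarrow> nat \<Rightarrow> 'a measure" where
  "eta \<eta>0 M G 0 = \<eta>0"
| "eta \<eta>0 M G (Suc n) = Psi (G n) (eta \<eta>0 M G n) \<bind> M (Suc n)"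

fun plaw :: "(nat \<Rightarrow> 'a measure) \<Rightarrow> 'a measure \<Rightarrow> (nat \<Rightarrow> 'a \<Rightarrow> 'a measure)
    \<Rightarrow> (nat \<Rightarrow> 'a \<Rightarrow> real) \<Rightarrow> nat \<Rightarrow> nat \<Rightarrow> (nat \<Rightarrow> 'a) measure" where
  "plaw S \<eta>0 M G N 0 = PiM {..<N} (\<lambda>_. \<eta>0)"
| "plaw S \<eta>0 M G N (Suc n) = plaw S \<eta>0 M G N n \<bind>
     (\<lambda>x. PiM {..<N} (\<lambda>i. Kmu (G n) (M (Suc n)) (emp (S n) N x) (x i)))"

text \<open>Qk M G p k f = Q_{p,p+k} f, where Q_{p+1}(x,dy) = G_p(x) M_{p+1}(x,dy).\<close>
fun Qk :: "(nat \<Rightarrow> 'a \<Rightarrow> 'a measure) \<Rightarrow> (nat \<Rightarrow> 'a \<Rightarrow> real) \<Rightarrow> nat \<Rightarrow> nat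
    \<Rightarrow> ('a \<Rightarrow> real) \<Rightarrow> 'a \<Rightarrow> real" where
  "Qk M G p 0 f = f"
| "Qk M G p (Suc k) f = (\<lambda>x. G p x * (\<integral>y. Qk M G (Suc p) k f y \<partial>(M (Suc p) x)))"

definition Q :: "(nat \<Rightarrow> 'a \<Rightarrow> 'a measure) \<Rightarrow> (nat \<Rightarrow> 'a \<Rightarrow> real) \<Rightarrow> nat \<Rightarrow> nat
    \<Rightarrow> ('a \<Rightarrow> real) \<Rightarrow> 'a \<Rightarrow> real" where
  "Q M G p n f = Qk M G p (n - p) f"

definition P :: "(nat \<Rightarrow> 'a \<Rightarrow> 'a measure) \<Rightarrow> (nat \<Rightarrow> 'a \<Rightarrow> real) \<Rightarrow> nat \<Rightarrow> nat
    \<Rightarrow> ('a \<Rightarrow> real) \<Rightarrow> 'a \<Rightarrow> real" where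
  "P M G p n f = (\<lambda>x. Q M G p n f x / Q M G p n (\<lambda>_. 1) x)"

definition qpn :: "(nat \<Rightarrow> 'a measure) \<Rightarrow> (nat \<Rightarrow> 'a \<Rightarrow> 'a measure) \<Rightarrow> (nat \<Rightarrow> 'a \<Rightarrow> real)
    \<Rightarrow> nat \<Rightarrow> nat \<Rightarrow> real" where
  "qpn S M G p n = (SUP xy\<in>space (S p) \<times> space (S p).
      Q M G p n (\<lambda>_. 1) (fst xy) / Q M G p n (\<lambda>_. 1) (snd xy))"

definition osc :: "'a set \<Rightarrow> ('a \<Rightarrow> real) \<Rightarrow> real" where
  "osc A f = (SUP xy\<in>A \<times> A. \<bar>f (fst xy) - f (snd xy)\<bar>)"

definition Osc1 :: "'a measure \<Rightarrow> ('a \<Rightarrow> real) set" where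
  "Osc1 S = {f \<in> borel_measurable S. \<forall>x\<in>space S. \<forall>y\<in>space S. \<bar>f x - f y\<bar> \<le> 1}"

definition beta :: "(nat \<Rightarrow> 'a measure) \<Rightarrow> (nat \<Rightarrow> 'a \<Rightarrow> 'a measure) \<Rightarrow> (nat \<Rightarrow> 'a \<Rightarrow> real)
    \<Rightarrow> nat \<Rightarrow> nat \<Rightarrow> real" where
  "beta S M G p n = (SUP f\<in>Osc1 (S n). osc (space (S p)) (P M G p n f))"

definition sigma1 :: "(nat \<Rightarrow> 'a measure) \<Rightarrow> (nat \<Rightarrow> 'a \<Rightarrow> 'a measure) \<Rightarrow> (nat \<Rightarrow> 'a \<Rightarrow> real)
    \<Rightarrow> nat \<Rightarrow> real" where
  "sigma1 S M G n = 4 * (\<Sum>p\<le>n. qpn S M G p n ^ 3 * beta S M G p n)"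

definition sigma2 :: "(nat \<Rightarrow> 'a measure) \<Rightarrow> (nat \<Rightarrow> 'a \<Rightarrow> 'a measure) \<Rightarrow> (nat \<Rightarrow> 'a \<Rightarrow> real)
    \<Rightarrow> nat \<Rightarrow> real" where
  "sigma2 S M G n = 2 * (\<Sum>p\<le>n. qpn S M G p n * beta S M G p n)"

definition ffact :: "nat \<Rightarrow> nat \<Rightarrow> real" where
  "ffact n k = fact n / fact (n - k)"

definition bconst :: "nat \<Rightarrow> real" where
  "bconst k = (if even k then
       (let m = k div 2 in (ffact (2*m) m / 2 ^ m) powr (1 / real k))
     else
       (let m = k div 2 in
         (ffact (2*m+1) (m+1) / sqrt (real m + 1/2) * 2 powr (- (real m + 1/2))) powr (1 / real k)))"

end

theory Submission
  imports Defs
begin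

text \<open>Write \<open>\<Phi>\<^sub>p(\<mu>) = \<mu>(Q\<^sub>p\<^sub>,\<^sub>n f) / \<mu>(Q\<^sub>p\<^sub>,\<^sub>n 1)\<close>. The error at time \<open>n\<close> telescopes over \<open>p\<close> into the differences
  of \<open>\<Phi>\<^sub>p\<close> at the empirical measure of time \<open>p\<close> and at its conditional mean given time \<open>p - 1\<close>. Each difference
  is a centred linear term, which has no bias, plus a remainder of order \<open>1/N\<close> that is a product of two
  centred averages of independent variables. Centred averages obey a Khintchine inequality with the constants
  \<open>b(m)\<close>: for even exponents, convexity bounds a centred variable with values in \<open>[-a, a]\<close> by \<open>\<plusminus>a\<close> with equal
  weights, and odd exponents follow by Cauchy--Schwarz. No law on path space is needed: the telescoping is an
  induction on \<open>p\<close> that conditions on one step and applies Minkowski's inequality twice.\<close>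

section \<open>Moments of sums of independent bounded variables\<close>

text \<open>Given the past, the particles of one step are independent but not identically
  distributed, since each kernel depends on the particle's own position. So the estimates are made
  for products of different measures, centred at the average of the individual means. In that
  average the acceptance probabilities drop out: what accepted particles keep and what rejected ones
  resample adds up to the limiting flow applied to the empirical measure. The centre of the error at
  time \<open>p + 1\<close> is therefore exactly the functional at time \<open>p\<close>, and the
  telescoping leaves no residue.

  In \<open>2 * q ^ 3 * b\<close> one \<open>q\<close> is the range of the normalised weight,
  \<open>2 * q * b\<close> is the width of the interval holding the normalised centred function, and
  the last \<open>q\<close> pays for dividing by the random normalisation. The two averages in the
  remainder use the same sample, so their product needs Cauchy-Schwarz; this brings in the moments
  of doubled order and hence \<open>bconst (2 * m) ^ 2\<close>. All one-step bounds are uniform in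
  the previous configuration, which is what lets them be summed.\<close>

lemma two_power_fact_le: "2 ^ j * fact j \<le> (fact (2 * j) :: real)"
proof (induction j)
  case (Suc j)
  have "2 ^ Suc j * fact (Suc j) = (2 * real (Suc j)) * (2 ^ j * fact j)"
    by simp
  also have "\<dots> \<le> (2 * real (Suc j)) * fact (2 * j)"
    using Suc by (intro mult_left_mono) auto
  also have "\<dots> \<le> (2 * real (Suc j)) * ((2 * real j + 1) * fact (2 * j))"
    by (intro mult_left_mono) (auto simp: algebra_simps)
  also have "\<dots> = fact (2 * Suc j)"
    by (simp add: algebra_simps)
  finally show ?case .
qed simp

text \<open>The moment of order \<open>2 * m\<close> of a standard Gaussian, that is
  \<open>(2m - 1)!!\<close>; it equals \<open>bconst (2 * m) ^ (2 * m)\<close>.\<close>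

definition even_const :: "nat \<Rightarrow> real" where
  "even_const m = fact (2 * m) / (2 ^ m * fact m)"

lemma even_const_pos: "0 < even_const m"
  by (simp add: even_const_def)

text \<open>The arithmetic of adding one fair sign to a sum of \<open>k\<close> variables. The bound
  holds term by term: replacing \<open>(2j)!\<close> by the smaller \<open>2 ^ j * j!\<close> turns
  the coefficients of order \<open>2 * m\<close> into those of the binomial expansion of
  \<open>(1 + k) ^ m\<close>.\<close>

lemma even_const_sum_le:
  "(\<Sum>j\<le>m. real ((2 * m) choose (2 * j)) * (even_const (m - j) * real k ^ (m - j)))
     \<le> even_const m * real (Suc k) ^ m"
proof -
  have "real ((2 * m) choose (2 * j)) * (even_const (m - j) * real k ^ (m - j))
      \<le> even_const m * (real (m choose j) * real k ^ (m - j))" if "j \<le> m" for j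
  proof -
    have b1: "real ((2 * m) choose (2 * j)) = fact (2 * m) / (fact (2 * j) * fact (2 * (m - j)))"
      using that by (subst binomial_fact) (auto simp: diff_mult_distrib2)
    have b2: "real (m choose j) = fact m / (fact j * fact (m - j))"
      using that by (subst binomial_fact) auto
    have p: "(2::real) ^ m = 2 ^ j * 2 ^ (m - j)"
      using that by (simp flip: power_add)
    have "real ((2 * m) choose (2 * j)) * even_const (m - j)
        = fact (2 * m) / (2 ^ (m - j) * fact (m - j)) * (1 / fact (2 * j))"
      unfolding b1 even_const_def by simp
    also have "\<dots> \<le> fact (2 * m) / (2 ^ (m - j) * fact (m - j)) * (1 / (2 ^ j * fact j))"
      using two_power_fact_le[of j] by (intro mult_left_mono divide_left_mono) auto
    also have "\<dots> = even_const m * real (m choose j)"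
      unfolding b2 even_const_def p by simp
    finally have "real ((2 * m) choose (2 * j)) * even_const (m - j) \<le> even_const m * real (m choose j)" .
    from mult_right_mono[OF this, of "real k ^ (m - j)"] show ?thesis
      by (simp add: mult.assoc)
  qed
  then have "(\<Sum>j\<le>m. real ((2 * m) choose (2 * j)) * (even_const (m - j) * real k ^ (m - j)))
      \<le> (\<Sum>j\<le>m. even_const m * (real (m choose j) * real k ^ (m - j)))"
    by (intro sum_mono) auto
  also have "\<dots> = even_const m * (1 + real k) ^ m"
    by (simp add: binomial_ring sum_distrib_left)
  finally show ?thesis by simp
qed

text \<open>Averaging over the two signs of \<open>a\<close> cancels the odd powers of
  \<open>a\<close>, so only even moments of \<open>s\<close> remain and the induction over the
  number of variables closes on even exponents.\<close>

lemma even_part_binomial: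
  fixes s a :: real
  shows "((s + a) ^ (2 * m) + (s - a) ^ (2 * m)) / 2
     = (\<Sum>j\<le>m. real ((2 * m) choose (2 * j)) * a ^ (2 * j) * s ^ (2 * (m - j)))"
proof -
  let ?g = "\<lambda>k. real ((2 * m) choose k) * a ^ k * s ^ (2 * m - k)"
  have "(s + a) ^ (2 * m) + (s - a) ^ (2 * m)
      = (\<Sum>k\<le>2 * m. ?g k) + (\<Sum>k\<le>2 * m. (-1) ^ k * ?g k)"
    using binomial_ring[of a s "2 * m"] binomial_ring[of "- a" s "2 * m"]
    by (simp add: power_minus[of a] mult_ac add.commute)
  also have "\<dots> = (\<Sum>k\<le>2 * m. if even k then 2 * ?g k else 0)"
    unfolding sum.distrib[symmetric] by (intro sum.cong) auto
  also have "\<dots> = (\<Sum>k\<in>{k\<in>{..2 * m}. even k}. 2 * ?g k)"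
    by (intro sum.inter_filter[symmetric]) simp
  also have "\<dots> = (\<Sum>j\<le>m. 2 * ?g (2 * j))"
  proof (rule sum.reindex_bij_witness[of _ "\<lambda>j. 2 * j" "\<lambda>k. k div 2"])
  qed auto
  finally show ?thesis
    by (simp add: sum_distrib_left[symmetric] diff_mult_distrib2)
qed

text \<open>\<open>s + z\<close> is a convex combination of \<open>s - a\<close> and
  \<open>s + a\<close>, and an even power is convex. The weights are affine in \<open>z\<close>, so
  integrating a centred \<open>z\<close> turns both into 1/2.\<close>

lemma even_power_two_point:
  fixes s z a :: real
  assumes "\<bar>z\<bar> \<le> a" "0 < a"
  shows "(s + z) ^ (2 * m) \<le> (a + z) / (2 * a) * (s + a) ^ (2 * m) + (a - z) / (2 * a) * (s - a) ^ (2 * m)"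
proof -
  define u where "u = (a + z) / (2 * a)"
  have u: "0 \<le> u" "u \<le> 1" "1 - u = (a - z) / (2 * a)"
    using assms by (auto simp: u_def field_simps)
  have "s + z = (1 - u) * (s - a) + u * (s + a)"
    using assms unfolding u_def by (simp add: field_simps)
  then have "(s + z) ^ (2 * m) \<le> (1 - u) * (s - a) ^ (2 * m) + u * (s + a) ^ (2 * m)"
    using convex_onD[OF convex_power_even[of "2 * m"], of u "s - a" "s + a"] u by simp
  then show ?thesis
    unfolding u(3) by (simp add: u_def)
qed

lemma (in prob_space) expectation_shift_even_power_le:
  fixes Z :: "'a \<Rightarrow> real"
  assumes [measurable]: "Z \<in> borel_measurable M"
    and bound: "\<And>x. x \<in> space M \<Longrightarrow> \<bar>Z x\<bar> \<le> a" and "0 \<le> a" and mean: "(\<integral>x. Z x \<partial>M) = 0"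
  shows "(\<integral>x. (s + Z x) ^ (2 * m) \<partial>M) \<le> ((s + a) ^ (2 * m) + (s - a) ^ (2 * m)) / 2"
\<comment> \<open>The weights of the two-point bound divide by \<open>2 * a\<close>; for
  \<open>a = 0\<close> the variable vanishes identically.\<close>
proof (cases "a = 0")
  case True
  then have "(\<integral>x. (s + Z x) ^ (2 * m) \<partial>M) = (\<integral>x. s ^ (2 * m) \<partial>M)"
    using bound by (intro Bochner_Integration.integral_cong) auto
  then show ?thesis using True by (simp add: prob_space)
next
  case False
  with \<open>0 \<le> a\<close> have a: "0 < a" by simp
  have intZ: "integrable M Z"
    using bound by (intro integrable_const_bound[of _ a]) auto
  have "integrable M (\<lambda>x. (s + Z x) ^ (2 * m))"
  proof (intro integrable_const_bound[of _ "(\<bar>s\<bar> + a) ^ (2 * m)"] AE_I2)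
    fix x assume "x \<in> space M"
    then have "\<bar>s + Z x\<bar> \<le> \<bar>s\<bar> + a" using bound[of x] by linarith
    then show "norm ((s + Z x) ^ (2 * m)) \<le> (\<bar>s\<bar> + a) ^ (2 * m)"
      unfolding real_norm_def power_abs by (intro power_mono) auto
  qed measurable
  then have "(\<integral>x. (s + Z x) ^ (2 * m) \<partial>M)
      \<le> (\<integral>x. (a + Z x) / (2 * a) * (s + a) ^ (2 * m) + (a - Z x) / (2 * a) * (s - a) ^ (2 * m) \<partial>M)"
    using intZ bound a
    by (intro integral_mono even_power_two_point) (auto intro!: integrable_mult_left)
  also have "\<dots> = (s + a) ^ (2 * m) * (1 / 2) + (s - a) ^ (2 * m) * (1 / 2)"
    using intZ a by (simp add: mean prob_space)
  finally show ?thesis by simp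
qed

lemma integral_abs_mult_le:
  fixes X Y :: "'a \<Rightarrow> real"
  assumes [measurable]: "X \<in> borel_measurable M" "Y \<in> borel_measurable M"
    and X: "integrable M (\<lambda>x. (X x)\<^sup>2)" and Y: "integrable M (\<lambda>x. (Y x)\<^sup>2)"
  shows "(\<integral>x. \<bar>X x * Y x\<bar> \<partial>M) \<le> sqrt ((\<integral>x. (X x)\<^sup>2 \<partial>M) * (\<integral>x. (Y x)\<^sup>2 \<partial>M))"
proof -
  have "\<bar>X x * Y x\<bar> \<le> (X x)\<^sup>2 + (Y x)\<^sup>2" for x
  proof -
    have "2 * (\<bar>X x\<bar> * \<bar>Y x\<bar>) \<le> (X x)\<^sup>2 + (Y x)\<^sup>2"
      using sum_squares_bound[of "\<bar>X x\<bar>" "\<bar>Y x\<bar>"] by (simp add: mult.assoc)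
    moreover have "0 \<le> \<bar>X x\<bar> * \<bar>Y x\<bar>" by simp
    ultimately show ?thesis unfolding abs_mult by linarith
  qed
  then have XY: "integrable M (\<lambda>x. \<bar>X x * Y x\<bar>)"
    by (intro Bochner_Integration.integrable_bound[OF Bochner_Integration.integrable_add[OF X Y]] AE_I2) auto
  have "(\<integral>\<^sup>+x. ennreal \<bar>X x\<bar> * ennreal \<bar>Y x\<bar> \<partial>M)\<^sup>2
      \<le> (\<integral>\<^sup>+x. (ennreal \<bar>X x\<bar>)\<^sup>2 \<partial>M) * (\<integral>\<^sup>+x. (ennreal \<bar>Y x\<bar>)\<^sup>2 \<partial>M)"
    by (intro Cauchy_Schwarz_nn_integral) auto
  also have "(\<lambda>x. ennreal \<bar>X x\<bar> * ennreal \<bar>Y x\<bar>) = (\<lambda>x. ennreal \<bar>X x * Y x\<bar>)"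
    by (simp add: ennreal_mult abs_mult)
  also have "(\<lambda>x. (ennreal \<bar>X x\<bar>)\<^sup>2) = (\<lambda>x. ennreal ((X x)\<^sup>2))"
    by (simp add: ennreal_power)
  also have "(\<lambda>x. (ennreal \<bar>Y x\<bar>)\<^sup>2) = (\<lambda>x. ennreal ((Y x)\<^sup>2))"
    by (simp add: ennreal_power)
  finally have "(\<integral>x. \<bar>X x * Y x\<bar> \<partial>M)\<^sup>2 \<le> (\<integral>x. (X x)\<^sup>2 \<partial>M) * (\<integral>x. (Y x)\<^sup>2 \<partial>M)"
    using X Y XY by (simp add: nn_integral_eq_integral ennreal_power flip: ennreal_mult)
  then show ?thesis
    by (rule real_le_rsqrt)
qed

lemma (in product_prob_space) even_moment_sum_le:
  fixes Z :: "'i \<Rightarrow> 'a \<Rightarrow> real"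
  assumes "finite J"
    and "\<And>i. i \<in> J \<Longrightarrow> Z i \<in> borel_measurable (M i)"
    and "\<And>i x. i \<in> J \<Longrightarrow> x \<in> space (M i) \<Longrightarrow> \<bar>Z i x\<bar> \<le> a" and "0 \<le> a"
    and "\<And>i. i \<in> J \<Longrightarrow> (\<integral>x. Z i x \<partial>M i) = 0"
  shows "(\<integral>x. (\<Sum>i\<in>J. Z i (x i)) ^ (2 * m) \<partial>PiM J M) \<le> even_const m * real (card J) ^ m * a ^ (2 * m)"
  using assms(1,2,3,5)
\<comment> \<open>Splitting off one variable leaves powers \<open>2 * (m - j)\<close> of the
  remaining sum, so the hypothesis is needed at all smaller exponents.\<close>
proof (induction J arbitrary: m)
  case empty
  interpret E: prob_space "PiM {} M" by (intro prob_space_PiM prob_space)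
  show ?case
    by (cases m) (auto simp: even_const_def E.prob_space)
next
  case (insert i J)
  interpret J: prob_space "PiM J M" by (intro prob_space_PiM prob_space)
  interpret iJ: prob_space "PiM (insert i J) M" by (intro prob_space_PiM prob_space)
  note [measurable] = insert.prems(1)
  define T where "T x = (\<Sum>j\<in>J. Z j (x j))" for x
  have [measurable]: "T \<in> borel_measurable (PiM J M)"
    unfolding T_def by measurable
  have T_bound: "\<bar>T x\<bar> \<le> real (card J) * a" if "x \<in> space (PiM J M)" for x
  proof -
    have "\<bar>T x\<bar> \<le> (\<Sum>j\<in>J. \<bar>Z j (x j)\<bar>)" unfolding T_def by (rule sum_abs)
    also have "\<dots> \<le> (\<Sum>j\<in>J. a)"
      using that insert.prems(2) by (intro sum_mono) (auto simp: space_PiM)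
    finally show ?thesis by simp
  qed
  have T_int: "integrable (PiM J M) (\<lambda>x. T x ^ k)" for k
    using T_bound by (intro J.integrable_const_bound[of _ "(real (card J) * a) ^ k"] AE_I2)
      (auto simp: power_abs intro!: power_mono)
  have int: "integrable (PiM (insert i J) M) (\<lambda>x. (\<Sum>j\<in>insert i J. Z j (x j)) ^ (2 * m))"
  proof (intro iJ.integrable_const_bound[of _ "(real (card (insert i J)) * a) ^ (2 * m)"] AE_I2)
    fix x assume x: "x \<in> space (PiM (insert i J) M)"
    have "\<bar>\<Sum>j\<in>insert i J. Z j (x j)\<bar> \<le> (\<Sum>j\<in>insert i J. \<bar>Z j (x j)\<bar>)" by (rule sum_abs)
    also have "\<dots> \<le> (\<Sum>j\<in>insert i J. a)"
      using x insert.prems(2) by (intro sum_mono) (auto simp: space_PiM)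
    finally show "norm ((\<Sum>j\<in>insert i J. Z j (x j)) ^ (2 * m)) \<le> (real (card (insert i J)) * a) ^ (2 * m)"
      unfolding real_norm_def power_abs by (intro power_mono) auto
  qed (use insert.prems(1) insert.hyps in measurable)
  let ?R = "\<lambda>x. \<Sum>j\<le>m. real ((2 * m) choose (2 * j)) * a ^ (2 * j) * T x ^ (2 * (m - j))"
  have "(\<integral>x. (\<Sum>j\<in>insert i J. Z j (x j)) ^ (2 * m) \<partial>PiM (insert i J) M)
      = (\<integral>x. (\<integral>y. (\<Sum>j\<in>insert i J. Z j ((x(i := y)) j)) ^ (2 * m) \<partial>M i) \<partial>PiM J M)"
    by (intro product_integral_insert insert.hyps int)
  also have "\<dots> = (\<integral>x. (\<integral>y. (T x + Z i y) ^ (2 * m) \<partial>M i) \<partial>PiM J M)"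
  proof -
    have "(\<Sum>j\<in>insert i J. Z j ((x(i := y)) j)) = T x + Z i y" for x y
    proof -
      have "(\<Sum>j\<in>J. Z j ((x(i := y)) j)) = T x"
        unfolding T_def using insert.hyps by (intro sum.cong) auto
      then show ?thesis using insert.hyps by simp
    qed
    then show ?thesis by simp
  qed
  \<comment> \<open>The sum over \<open>J\<close> plays the role of the constant shift
    \<open>s\<close> while the variable \<open>i\<close> is integrated. Only the majorant needs to
    be integrable and nonnegative here.\<close>
  also have "\<dots> \<le> (\<integral>x. ?R x \<partial>PiM J M)"
  proof (rule integral_mono')
    show "integrable (PiM J M) ?R"
      using T_int by (intro Bochner_Integration.integrable_sum integrable_mult_right)
    show "0 \<le> ?R x" for x
      using \<open>0 \<le> a\<close> by (intro sum_nonneg mult_nonneg_nonneg) auto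
    show "(\<integral>y. (T x + Z i y) ^ (2 * m) \<partial>M i) \<le> ?R x" for x
      unfolding even_part_binomial[symmetric]
      using insert.prems \<open>0 \<le> a\<close> by (intro prob_space.expectation_shift_even_power_le[OF prob_space]) auto
  qed
  also have "\<dots> = (\<Sum>j\<le>m. real ((2 * m) choose (2 * j)) * a ^ (2 * j) * (\<integral>x. T x ^ (2 * (m - j)) \<partial>PiM J M))"
    using T_int by (subst Bochner_Integration.integral_sum) (auto intro!: integrable_mult_right)
  also have "\<dots> \<le> (\<Sum>j\<le>m. real ((2 * m) choose (2 * j)) * a ^ (2 * j)
      * (even_const (m - j) * real (card J) ^ (m - j) * a ^ (2 * (m - j))))"
    unfolding T_def using insert \<open>0 \<le> a\<close>
    by (intro sum_mono mult_left_mono insert.IH) auto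
  also have "\<dots> = (\<Sum>j\<le>m. real ((2 * m) choose (2 * j)) * (even_const (m - j) * real (card J) ^ (m - j))) * a ^ (2 * m)"
    unfolding sum_distrib_right
  proof (intro sum.cong refl)
    fix j assume "j \<in> {..m}"
    then have "a ^ (2 * m) = a ^ (2 * j) * a ^ (2 * (m - j))"
      by (simp flip: power_add add: diff_mult_distrib2)
    then show "real ((2 * m) choose (2 * j)) * a ^ (2 * j) * (even_const (m - j) * real (card J) ^ (m - j) * a ^ (2 * (m - j)))
        = real ((2 * m) choose (2 * j)) * (even_const (m - j) * real (card J) ^ (m - j)) * a ^ (2 * m)"
      by simp
  qed
  also have "\<dots> \<le> (even_const m * real (Suc (card J)) ^ m) * a ^ (2 * m)"
    using \<open>0 \<le> a\<close> by (intro mult_right_mono even_const_sum_le) auto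
  finally show ?case
    using insert.hyps by simp
qed

section \<open>The constants \<open>b(k)\<close> and the Khintchine inequality for all
  exponents\<close>

lemma bconst_nonneg: "0 \<le> bconst k"
  by (simp add: bconst_def Let_def)

lemma powr_inverse_power:
  fixes C :: real
  assumes "0 < C" "0 < k"
  shows "(C powr (1 / real k)) ^ k = C"
  using assms by (simp add: powr_powr flip: powr_realpow)

lemma bconst_even_power: "bconst (2 * m) ^ (2 * m) = even_const m"
proof (cases "m = 0")
  case False
  have "bconst (2 * m) = even_const m powr (1 / real (2 * m))"
    by (simp add: bconst_def Let_def ffact_def even_const_def mult.commute)
  then show ?thesis
    using powr_inverse_power[OF even_const_pos, of "2 * m" m] False by simp
qed (simp add: even_const_def)

text \<open>The odd constants are geometric means of the two neighbouring even ones, exactly the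
  form that Cauchy-Schwarz produces. The proof compares squares, which removes the root of
  \<open>m + 1/2\<close> and the half-integer power of 2.\<close>

lemma bconst_odd_power: "bconst (2 * m + 1) ^ (2 * m + 1) = sqrt (even_const m * even_const (Suc m))"
proof -
  define C where "C = ffact (2 * m + 1) (m + 1) / sqrt (real m + 1/2) * 2 powr (- (real m + 1/2))"
  have C: "0 < C"
    unfolding C_def ffact_def by simp
  have f: "ffact (2 * m + 1) (m + 1) = (2 * real m + 1) * fact (2 * m) / fact m"
    by (simp add: ffact_def)
  have p: "(2 powr (- (real m + 1/2)))\<^sup>2 = 1 / (2 ^ m * 2 ^ Suc m :: real)"
  proof -
    have "(2 powr (- (real m + 1/2)))\<^sup>2 = (2::real) powr (- (real m + 1/2) + - (real m + 1/2))"
      by (simp only: power2_eq_square powr_add)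
    also have "- (real m + 1/2) + - (real m + 1/2) = - (real (2 * m + 1))"
      by simp
    also have "2 powr (- (real (2 * m + 1))) = 1 / (2::real) ^ (2 * m + 1)"
      by (subst powr_minus, subst powr_realpow) (auto simp: field_simps)
    also have "(2::real) ^ (2 * m + 1) = 2 ^ m * 2 ^ Suc m"
      unfolding mult_2 power_add power_Suc power_one_right by simp
    finally show ?thesis .
  qed
  have "C\<^sup>2 = ((2 * real m + 1) * fact (2 * m) / fact m)\<^sup>2 / (real m + 1/2) * (1 / (2 ^ m * 2 ^ Suc m))"
    unfolding C_def f power_mult_distrib power_divide p by simp
  also have "\<dots> = ((2 * real m + 1) * fact (2 * m) * (2 * fact (2 * m)) / (fact m * fact m)) * (1 / (2 ^ m * 2 ^ Suc m))"
  proof -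
    have "(2 * r * x / y)\<^sup>2 / r = 2 * r * x * (2 * x) / (y * y)" if "0 < r" for r x y :: real
      using that by (simp add: power2_eq_square)
    from this[of "real m + 1/2" "fact (2 * m)" "fact m"]
    have "((2 * real m + 1) * fact (2 * m) / fact m)\<^sup>2 / (real m + 1/2)
      = ((2 * real m + 1) * fact (2 * m) * (2 * fact (2 * m)) / (fact m * fact m))"
      by (simp add: distrib_left)
    then show ?thesis by simp
  qed
  also have "\<dots> = even_const m * even_const (Suc m)"
  proof -
    have "(fact (2 * Suc m) :: real) = 2 * (real m + 1) * ((2 * real m + 1) * fact (2 * m))"
      by (simp add: algebra_simps)
    moreover have "(fact (Suc m) :: real) = (real m + 1) * fact m" by (simp add: algebra_simps)
    ultimately show ?thesis
      unfolding even_const_def by (simp add: divide_simps)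
  qed
  finally have C2: "C = sqrt (even_const m * even_const (Suc m))"
    using C by (intro real_sqrt_unique[symmetric]) auto
  have "bconst (2 * m + 1) = C powr (1 / real (2 * m + 1))"
    by (simp add: bconst_def Let_def C_def)
  then show ?thesis
    unfolding C2[symmetric] using powr_inverse_power[OF C, of "2 * m + 1"] by simp
qed

lemma (in product_prob_space) abs_moment_sum_le:
  fixes Z :: "'i \<Rightarrow> 'a \<Rightarrow> real"
  assumes J: "finite J"
    and Z: "\<And>i. i \<in> J \<Longrightarrow> Z i \<in> borel_measurable (M i)"
    and bound: "\<And>i x. i \<in> J \<Longrightarrow> x \<in> space (M i) \<Longrightarrow> \<bar>Z i x\<bar> \<le> a" and a: "0 \<le> a"
    and mean: "\<And>i. i \<in> J \<Longrightarrow> (\<integral>x. Z i x \<partial>M i) = 0"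
  shows "(\<integral>x. \<bar>\<Sum>i\<in>J. Z i (x i)\<bar> ^ k \<partial>PiM J M) \<le> (bconst k * (sqrt (real (card J)) * a)) ^ k"
proof -
  interpret J: prob_space "PiM J M" by (intro prob_space_PiM prob_space)
  note [measurable] = Z
  define T where "T x = (\<Sum>j\<in>J. Z j (x j))" for x
  have [measurable]: "T \<in> borel_measurable (PiM J M)"
    unfolding T_def by measurable
  let ?r = "sqrt (real (card J))"
  have even: "(\<integral>x. T x ^ (2 * m) \<partial>PiM J M) \<le> even_const m * (?r * a) ^ (2 * m)" for m
    using even_moment_sum_le[OF assms, of m] unfolding T_def
    by (simp add: power_mult_distrib power_mult[of ?r] mult.assoc)
  have T_int: "integrable (PiM J M) (\<lambda>x. T x ^ n)" for n
  proof (intro J.integrable_const_bound[of _ "(real (card J) * a) ^ n"] AE_I2)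
    fix x assume x: "x \<in> space (PiM J M)"
    have "\<bar>T x\<bar> \<le> (\<Sum>j\<in>J. \<bar>Z j (x j)\<bar>)" unfolding T_def by (rule sum_abs)
    also have "\<dots> \<le> (\<Sum>j\<in>J. a)"
      using x bound by (intro sum_mono) (auto simp: space_PiM)
    finally show "norm (T x ^ n) \<le> (real (card J) * a) ^ n"
      unfolding real_norm_def power_abs by (intro power_mono) auto
  qed measurable
  show ?thesis
  proof (cases "even k")
    case True
    then obtain m where k: "k = 2 * m" by blast
    have "(\<integral>x. \<bar>T x\<bar> ^ k \<partial>PiM J M) = (\<integral>x. T x ^ (2 * m) \<partial>PiM J M)"
      unfolding k by (simp add: power_even_abs)
    also have "\<dots> \<le> bconst (2 * m) ^ (2 * m) * (?r * a) ^ (2 * m)"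
      unfolding bconst_even_power by (rule even)
    finally show ?thesis
      unfolding T_def k by (simp add: power_mult_distrib)
  next
    case False
    then obtain m where k: "k = 2 * m + 1" by (rule oddE)
    \<comment> \<open>The exponent \<open>2m + 1\<close> is split as \<open>m + (m + 1)\<close>, so
      that both squared factors carry the even exponents \<open>2m\<close> and
      \<open>2m + 2\<close>.\<close>
    have "(\<integral>x. \<bar>T x\<bar> ^ k \<partial>PiM J M) = (\<integral>x. \<bar>T x ^ m * T x ^ Suc m\<bar> \<partial>PiM J M)"
      unfolding k power_add[symmetric] power_abs[symmetric] by (simp add: mult_2)
    also have "\<dots> \<le> sqrt ((\<integral>x. (T x ^ m)\<^sup>2 \<partial>PiM J M) * (\<integral>x. (T x ^ Suc m)\<^sup>2 \<partial>PiM J M))"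
      by (intro integral_abs_mult_le) (auto simp: power_mult[symmetric] T_int simp del: power_Suc)
    also have "\<dots> \<le> sqrt ((even_const m * (?r * a) ^ (2 * m)) * (even_const (Suc m) * (?r * a) ^ (2 * Suc m)))"
    proof (intro real_sqrt_le_mono mult_mono)
      show "(\<integral>x. (T x ^ m)\<^sup>2 \<partial>PiM J M) \<le> even_const m * (?r * a) ^ (2 * m)"
        using even[of m] by (simp add: power_mult[symmetric] mult.commute)
      show "(\<integral>x. (T x ^ Suc m)\<^sup>2 \<partial>PiM J M) \<le> even_const (Suc m) * (?r * a) ^ (2 * Suc m)"
        using even[of "Suc m"] by (simp only: power_mult[symmetric] mult.commute[of "Suc m" 2])
    qed (use even_const_pos[of m] a in auto)
    also have "\<dots> = sqrt (even_const m * even_const (Suc m)) * sqrt (((?r * a) ^ k)\<^sup>2)"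
      unfolding real_sqrt_mult[symmetric] k
      by (simp add: power_mult[symmetric] power_add mult_2 power2_eq_square mult_ac)
    also have "\<dots> = bconst k ^ k * (?r * a) ^ k"
      using a unfolding k bconst_odd_power by simp
    finally show ?thesis
      unfolding T_def by (simp add: power_mult_distrib)
  qed
qed

lemma (in product_prob_space) abs_moment_average_le:
  fixes Z :: "'i \<Rightarrow> 'a \<Rightarrow> real"
  assumes "finite J" "J \<noteq> {}"
    and "\<And>i. i \<in> J \<Longrightarrow> Z i \<in> borel_measurable (M i)"
    and "\<And>i x. i \<in> J \<Longrightarrow> x \<in> space (M i) \<Longrightarrow> \<bar>Z i x\<bar> \<le> a" and "0 \<le> a"
    and "\<And>i. i \<in> J \<Longrightarrow> (\<integral>x. Z i x \<partial>M i) = 0"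
  shows "(\<integral>x. \<bar>(\<Sum>i\<in>J. Z i (x i)) / real (card J)\<bar> ^ k \<partial>PiM J M)
    \<le> (bconst k * a / sqrt (real (card J))) ^ k"
proof -
  have n: "0 < real (card J)" using assms by (simp add: card_gt_0_iff)
  have "(\<integral>x. \<bar>(\<Sum>i\<in>J. Z i (x i)) / real (card J)\<bar> ^ k \<partial>PiM J M)
    = (\<integral>x. \<bar>\<Sum>i\<in>J. Z i (x i)\<bar> ^ k \<partial>PiM J M) / real (card J) ^ k"
    by (simp add: power_divide)
  also have "\<dots> \<le> (bconst k * (sqrt (real (card J)) * a)) ^ k / real (card J) ^ k"
    using assms n by (intro divide_right_mono abs_moment_sum_le) auto
  also have "\<dots> = (bconst k * a / sqrt (real (card J))) ^ k"
  proof -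
    have "bconst k * (sqrt (real (card J)) * a) / real (card J) = bconst k * a / sqrt (real (card J))"
      using n real_div_sqrt[of "real (card J)"] by (simp add: field_simps)
    then show ?thesis by (simp flip: power_divide)
  qed
  finally show ?thesis .
qed

section \<open>Minkowski's inequality in terms of \<open>k\<close>-th powers\<close>

lemma add_power_le_weighted:
  fixes x y A B :: real
  assumes "0 \<le> x" "0 \<le> y" "0 < A" "0 < B"
  shows "(x + y) ^ k \<le> (A + B) ^ k * (A / (A + B) * (x ^ k / A ^ k) + B / (A + B) * (y ^ k / B ^ k))"
proof -
  define t where "t = B / (A + B)"
  have t: "0 \<le> t" "t \<le> 1" "1 - t = A / (A + B)"
    using assms by (auto simp: t_def field_simps)
  have conv: "convex_on {0::real..} (\<lambda>x. x ^ k)"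
  proof (cases "even k")
    case True
    show ?thesis by (rule convex_on_subset[OF convex_power_even[OF True]]) auto
  qed (rule convex_power_odd)
  \<comment> \<open>\<open>(x + y) / (A + B)\<close> is the average of \<open>x / A\<close> and
    \<open>y / B\<close> with weights proportional to \<open>A\<close> and \<open>B\<close>; then
    the \<open>k\<close>-th power is convex on the nonnegative reals.\<close>
  have "((1 - t) * (x / A) + t * (y / B)) ^ k \<le> (1 - t) * (x / A) ^ k + t * (y / B) ^ k"
    using convex_onD[OF conv t(1,2), of "x / A" "y / B"] assms by simp
  moreover have "(1 - t) * (x / A) + t * (y / B) = (x + y) / (A + B)"
    unfolding t(3) unfolding t_def using assms by (simp add: add_divide_distrib)
  ultimately have "((x + y) / (A + B)) ^ k \<le> A / (A + B) * (x / A) ^ k + B / (A + B) * (y / B) ^ k"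
    unfolding t(3) by (simp add: t_def)
  then show ?thesis
    using assms by (simp add: power_divide pos_divide_le_eq mult.commute)
qed

text \<open>Minkowski with upper bounds \<open>A\<close>, \<open>B\<close> in place of the norms.
  Roots are thus avoided throughout the induction over time and taken only once at the end.\<close>

lemma integral_abs_add_power_le:
  fixes X Y :: "'a \<Rightarrow> real"
  assumes X: "integrable M (\<lambda>x. \<bar>X x\<bar> ^ k)" "(\<integral>x. \<bar>X x\<bar> ^ k \<partial>M) \<le> A ^ k"
    and Y: "integrable M (\<lambda>x. \<bar>Y x\<bar> ^ k)" "(\<integral>x. \<bar>Y x\<bar> ^ k \<partial>M) \<le> B ^ k"
    and AB: "0 \<le> A" "0 \<le> B"
  shows "(\<integral>x. \<bar>X x + Y x\<bar> ^ k \<partial>M) \<le> (A + B) ^ k"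
proof -
  \<comment> \<open>The convexity weights divide by \<open>A\<close> and \<open>B\<close>, which may
    be zero; both are raised by \<open>e\<close>, and \<open>e\<close> tends to 0
    afterwards.\<close>
  have le: "(\<integral>x. \<bar>X x + Y x\<bar> ^ k \<partial>M) \<le> (A + B + 2 * e) ^ k" if e: "0 < e" for e
  proof -
    define A' B' where "A' = A + e" and "B' = B + e"
    have pos: "0 < A'" "0 < B'" and sum: "A' + B' = A + B + 2 * e"
      using e AB by (auto simp: A'_def B'_def)
    have XA: "(\<integral>x. \<bar>X x\<bar> ^ k \<partial>M) / A' ^ k \<le> 1"
      using order_trans[OF X(2) power_mono[of A A' k]] pos AB e by (simp add: A'_def)
    have YB: "(\<integral>x. \<bar>Y x\<bar> ^ k \<partial>M) / B' ^ k \<le> 1"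
      using order_trans[OF Y(2) power_mono[of B B' k]] pos AB e by (simp add: B'_def)
    have "(\<integral>x. \<bar>X x + Y x\<bar> ^ k \<partial>M)
      \<le> (\<integral>x. (A' + B') ^ k * (A' / (A' + B') * (\<bar>X x\<bar> ^ k / A' ^ k) + B' / (A' + B') * (\<bar>Y x\<bar> ^ k / B' ^ k)) \<partial>M)"
    proof (rule integral_mono')
      fix x
      have "\<bar>X x + Y x\<bar> ^ k \<le> (\<bar>X x\<bar> + \<bar>Y x\<bar>) ^ k"
        by (intro power_mono) auto
      also note add_power_le_weighted[OF _ _ pos]
      finally show "\<bar>X x + Y x\<bar> ^ k \<le> (A' + B') ^ k * (A' / (A' + B') * (\<bar>X x\<bar> ^ k / A' ^ k) + B' / (A' + B') * (\<bar>Y x\<bar> ^ k / B' ^ k))"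
        by simp
    qed (use X Y pos in auto)
    also have "\<dots> = (A' + B') ^ k * (A' / (A' + B') * ((\<integral>x. \<bar>X x\<bar> ^ k \<partial>M) / A' ^ k) + B' / (A' + B') * ((\<integral>x. \<bar>Y x\<bar> ^ k \<partial>M) / B' ^ k))"
      using X Y by simp
    also have "\<dots> \<le> (A' + B') ^ k * (A' / (A' + B') * 1 + B' / (A' + B') * 1)"
      using XA YB pos by (intro mult_left_mono add_mono) auto
    also have "\<dots> = (A' + B') ^ k"
      using pos by (simp add: add_divide_distrib[symmetric])
    finally show ?thesis unfolding sum .
  qed
  have "((\<lambda>e. (A + B + 2 * e) ^ k) \<longlongrightarrow> (A + B + 2 * 0) ^ k) (at_right 0)"
    by (intro tendsto_intros)
  moreover have "eventually (\<lambda>e. (\<integral>x. \<bar>X x + Y x\<bar> ^ k \<partial>M) \<le> (A + B + 2 * e) ^ k) (at_right 0)"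
    using le by (auto simp: eventually_at_filter)
  ultimately have "(\<integral>x. \<bar>X x + Y x\<bar> ^ k \<partial>M) \<le> (A + B + 2 * 0) ^ k"
    by (rule tendsto_lowerbound) simp
  then show ?thesis by simp
qed

section \<open>Ratios of averages of independent variables\<close>

lemma (in product_prob_space) integral_PiM_component:
  fixes h :: "'a \<Rightarrow> real"
  assumes "finite J" "i \<in> J" "h \<in> borel_measurable (M i)"
  shows "(\<integral>x. h (x i) \<partial>PiM J M) = (\<integral>y. h y \<partial>M i)"
  using assms by (subst distr_PiM_component[of J M i, symmetric]) (auto simp: integral_distr prob_space)

lemma (in prob_space) integral_in_bounds:
  fixes h :: "'a \<Rightarrow> real"
  assumes "h \<in> borel_measurable M" and lo: "\<And>x. x \<in> space M \<Longrightarrow> l \<le> h x" and up: "\<And>x. x \<in> space M \<Longrightarrow> h x \<le> u"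
  shows "l \<le> (\<integral>x. h x \<partial>M)" "(\<integral>x. h x \<partial>M) \<le> u"
proof -
  have "integrable M h"
    using assms by (intro integrable_const_bound[of _ "max \<bar>l\<bar> \<bar>u\<bar>"]) fastforce+
  then show "l \<le> (\<integral>x. h x \<partial>M)" "(\<integral>x. h x \<partial>M) \<le> u"
    using lo up by (auto intro!: integral_ge_const integral_le_const)
qed

text \<open>A value and its mean both lie in \<open>[l, u]\<close>, so the centred variable is
  bounded by the width \<open>u - l\<close>. The means may differ from index to index, hence the
  average of means.\<close>

lemma (in product_prob_space) centered_average_moment_le:
  fixes h :: "'a \<Rightarrow> real"
  assumes J: "finite J" "J \<noteq> {}"
    and h: "\<And>i. i \<in> J \<Longrightarrow> h \<in> borel_measurable (M i)"
    and bounds: "\<And>i x. i \<in> J \<Longrightarrow> x \<in> space (M i) \<Longrightarrow> l \<le> h x"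
      "\<And>i x. i \<in> J \<Longrightarrow> x \<in> space (M i) \<Longrightarrow> h x \<le> u"
    and lu: "l \<le> u"
  shows "(\<integral>x. \<bar>(\<Sum>i\<in>J. h (x i)) / real (card J) - (\<Sum>i\<in>J. \<integral>y. h y \<partial>M i) / real (card J)\<bar> ^ k \<partial>PiM J M)
    \<le> (bconst k * (u - l) / sqrt (real (card J))) ^ k"
proof -
  have "(\<integral>x. \<bar>(\<Sum>i\<in>J. h (x i) - (\<integral>y. h y \<partial>M i)) / real (card J)\<bar> ^ k \<partial>PiM J M)
    \<le> (bconst k * (u - l) / sqrt (real (card J))) ^ k"
  proof (rule abs_moment_average_le)
    fix i x assume i: "i \<in> J" and x: "x \<in> space (M i)"
    have "l \<le> (\<integral>y. h y \<partial>M i)" "(\<integral>y. h y \<partial>M i) \<le> u"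
      using prob_space.integral_in_bounds[OF prob_space h[OF i] bounds(1)[OF i] bounds(2)[OF i]] by auto
    then show "\<bar>h x - (\<integral>y. h y \<partial>M i)\<bar> \<le> u - l"
      using bounds(1)[OF i x] bounds(2)[OF i x] by (auto simp: abs_le_iff)
  next
    fix i assume i: "i \<in> J"
    have "integrable (M i) h"
      using bounds[OF i] h[OF i] by (intro M.integrable_const_bound[of _ "max \<bar>l\<bar> \<bar>u\<bar>"]) fastforce+
    then show "(\<integral>x. h x - (\<integral>y. h y \<partial>M i) \<partial>M i) = 0"
      using M.prob_space by simp
  qed (use J h lu in auto)
  then show ?thesis
    by (simp add: sum_subtractf diff_divide_distrib)
qed

text \<open>The error of the ratio of averages is split into a centred linear term and a remainder that
  is a product of two centred averages: with \<open>g = w / \<nu> w\<close> and \<open>h = (u - c w) / \<nu> w\<close>, where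
  \<open>c = \<nu> u / \<nu> w\<close>, the error equals \<open>\<mu> h / \<mu> g = \<mu> h - (\<mu> g - 1) (\<mu> h) / \<mu> g\<close>.\<close>
lemma (in product_prob_space) ratio_average_error:
  fixes u w :: "'a \<Rightarrow> real" and q b :: real and S :: "'a measure"
  assumes J: "finite J" "J \<noteq> {}"
    and sets_M: "\<And>i. i \<in> J \<Longrightarrow> sets (M i) = sets S"
    and meas: "u \<in> borel_measurable S" "w \<in> borel_measurable S"
    and w_pos: "\<And>x. x \<in> space S \<Longrightarrow> 0 < w x"
    and w_ratio: "\<And>x y. x \<in> space S \<Longrightarrow> y \<in> space S \<Longrightarrow> w x \<le> q * w y"
    and u_osc: "\<And>x y. x \<in> space S \<Longrightarrow> y \<in> space S \<Longrightarrow> \<bar>u x / w x - u y / w y\<bar> \<le> b"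
  defines "R \<equiv> \<lambda>x. (\<Sum>i\<in>J. u (x i)) / (\<Sum>i\<in>J. w (x i))
      - (\<Sum>i\<in>J. \<integral>y. u y \<partial>M i) / (\<Sum>i\<in>J. \<integral>y. w y \<partial>M i)"
  shows "\<bar>\<integral>x. R x \<partial>PiM J M\<bar> \<le> 2 * q ^ 3 * b / real (card J)"
    and "(\<integral>x. \<bar>R x\<bar> ^ k \<partial>PiM J M)
      \<le> (bconst (2 * k) ^ 2 * (2 * q ^ 3 * b) / real (card J) + bconst k * (2 * q * b) / sqrt (real (card J))) ^ k"
    and "\<And>x. x \<in> space (PiM J M) \<Longrightarrow> \<bar>R x\<bar> \<le> b"
proof -
  let ?n = "real (card J)"
  have n: "0 < ?n" using J by (simp add: card_gt_0_iff)
  have space_M: "space (M i) = space S" if "i \<in> J" for i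
    using sets_M[OF that] by (rule sets_eq_imp_space_eq)
  have meas_M: "h \<in> borel_measurable (M i)" if "h \<in> borel_measurable S" "i \<in> J" for h :: "'a \<Rightarrow> real" and i
    using that(1) measurable_cong_sets[OF sets_M[OF that(2)] refl] by auto
  obtain i0 where i0: "i0 \<in> J" using J by auto
  obtain y0 where y0: "y0 \<in> space S"
    using prob_space.not_empty[OF prob_space[of i0]] space_M[OF i0] by auto
  have q: "1 \<le> q"
    using w_ratio[OF y0 y0] w_pos[OF y0] by simp
  have b: "0 \<le> b"
    using u_osc[OF y0 y0] by simp
  interpret pr: prob_space "PiM J M" by (intro prob_space_PiM prob_space)
  define \<nu> where "\<nu> h = (\<Sum>i\<in>J. \<integral>y. h y \<partial>M i) / ?n" for h :: "'a \<Rightarrow> real"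
  define \<mu> where "\<mu> h x = (\<Sum>i\<in>J. h (x i)) / ?n" for h :: "'a \<Rightarrow> real" and x
  have \<nu>_bounds: "l \<le> \<nu> h" "\<nu> h \<le> m"
    if "h \<in> borel_measurable S" "\<And>x. x \<in> space S \<Longrightarrow> l \<le> h x" "\<And>x. x \<in> space S \<Longrightarrow> h x \<le> m" for h l m
  proof -
    have "l \<le> (\<integral>y. h y \<partial>M i) \<and> (\<integral>y. h y \<partial>M i) \<le> m" if "i \<in> J" for i
      using prob_space.integral_in_bounds[OF prob_space meas_M, of h i l m] that \<open>h \<in> _\<close>
        \<open>\<And>x. x \<in> space S \<Longrightarrow> l \<le> h x\<close> \<open>\<And>x. x \<in> space S \<Longrightarrow> h x \<le> m\<close> space_M by auto
    then have "?n * l \<le> (\<Sum>i\<in>J. \<integral>y. h y \<partial>M i)" "(\<Sum>i\<in>J. \<integral>y. h y \<partial>M i) \<le> ?n * m"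
      by (auto intro: sum_bounded_above sum_bounded_below)
    then show "l \<le> \<nu> h" "\<nu> h \<le> m"
      using n by (auto simp: \<nu>_def field_simps)
  qed
  have \<mu>_bounds: "l \<le> \<mu> h x" "\<mu> h x \<le> m"
    if "x \<in> space (PiM J M)" "\<And>x. x \<in> space S \<Longrightarrow> l \<le> h x" "\<And>x. x \<in> space S \<Longrightarrow> h x \<le> m" for h l m x
  proof -
    have "l \<le> h (x i) \<and> h (x i) \<le> m" if "i \<in> J" for i
      using that \<open>x \<in> _\<close> space_M[OF that] \<open>\<And>x. x \<in> space S \<Longrightarrow> l \<le> h x\<close> \<open>\<And>x. x \<in> space S \<Longrightarrow> h x \<le> m\<close>
      by (auto simp: space_PiM PiE_def Pi_def)
    then have "?n * l \<le> (\<Sum>i\<in>J. h (x i))" "(\<Sum>i\<in>J. h (x i)) \<le> ?n * m"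
      by (auto intro: sum_bounded_above sum_bounded_below)
    then show "l \<le> \<mu> h x" "\<mu> h x \<le> m"
      using n by (auto simp: \<mu>_def field_simps)
  qed
  have \<mu>_meas: "\<mu> h \<in> borel_measurable (PiM J M)" if "h \<in> borel_measurable S" for h
    unfolding \<mu>_def using meas_M[OF that] by measurable
  have int_S: "integrable (M i) h" if "h \<in> borel_measurable S" "\<And>x. x \<in> space S \<Longrightarrow> \<bar>h x\<bar> \<le> m" "i \<in> J" for h :: "'a \<Rightarrow> real" and m i
    using that meas_M[OF that(1,3)] space_M by (intro finite_measure.integrable_const_bound[of _ _ m])
      (auto intro: prob_space.finite_measure prob_space)
  have w_bounds: "w y0 / q \<le> w x" "w x \<le> q * w y0" if "x \<in> space S" for x
    using w_ratio[OF that y0] w_ratio[OF y0 that] q by (auto simp: field_simps)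
  \<comment> \<open>Averaging \<open>w x \<le> q * w y\<close> over \<open>y\<close>, and over
    \<open>x\<close>, compares each value of \<open>w\<close> with its mean, so the normalised
    weight \<open>g\<close> lies between \<open>1 / q\<close> and \<open>q\<close>.\<close>
  have \<nu>w_upper: "w x \<le> q * \<nu> w" and \<nu>w_lower: "\<nu> w \<le> q * w x" if x: "x \<in> space S" for x
  proof -
    have "w x / q \<le> \<nu> w" "\<nu> w \<le> q * w x"
      using w_ratio[OF x] w_ratio[OF _ x] q
      by (intro \<nu>_bounds[of w "w x / q" "q * w x"] meas; auto simp: field_simps)+
    then show "w x \<le> q * \<nu> w" "\<nu> w \<le> q * w x" using q by (auto simp: field_simps)
  qed
  have \<nu>w: "0 < \<nu> w"
    using \<nu>w_upper[OF y0] w_pos[OF y0] q by (smt (verit) mult_nonneg_nonpos)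
  define c where "c = \<nu> u / \<nu> w"
  define g where "g x = w x / \<nu> w" for x
  define h where "h x = (u x - c * w x) / \<nu> w" for x
  note [measurable] = meas
  have gh_meas [measurable]: "g \<in> borel_measurable S" "h \<in> borel_measurable S"
    unfolding g_def h_def by measurable
  have g_bounds: "1 / q \<le> g x" "g x \<le> q" if "x \<in> space S" for x
    using \<nu>w_upper[OF that] \<nu>w_lower[OF that] \<nu>w q by (auto simp: g_def field_simps)
  have w_abs: "\<bar>w x\<bar> \<le> q * w y0" if "x \<in> space S" for x
    using w_bounds[OF that] w_pos[OF that] by simp
  have u_abs: "\<bar>u x\<bar> \<le> q * w y0 * (\<bar>u y0 / w y0\<bar> + b)" if "x \<in> space S" for x
  proof -
    have "\<bar>u x\<bar> = w x * \<bar>u x / w x\<bar>" using w_pos[OF that] by simp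
    also have "\<dots> \<le> (q * w y0) * (\<bar>u y0 / w y0\<bar> + b)"
    proof (rule mult_mono)
      show "\<bar>u x / w x\<bar> \<le> \<bar>u y0 / w y0\<bar> + b" using u_osc[OF that y0] by linarith
    qed (use w_bounds[OF that] w_pos[OF that] w_pos[OF y0] q in auto)
    finally show ?thesis .
  qed
  note int_u = int_S[OF meas(1) u_abs] and int_w = int_S[OF meas(2) w_abs]
  have lin: "\<nu> (\<lambda>x. s * u x + t * w x) = s * \<nu> u + t * \<nu> w" for s t
    unfolding \<nu>_def using int_u int_w
    by (simp add: sum.distrib sum_distrib_left add_divide_distrib)
  \<comment> \<open>The constant \<open>c\<close> is an average of the quotients
    \<open>u / w\<close> with weights given by \<open>w\<close>, so it is within the oscillation
    \<open>b\<close> of each of them. The proof fixes one quotient \<open>r\<close> and integrates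
    \<open>(r - b) * w \<le> u \<le> (r + b) * w\<close>.\<close>
  have u_c: "\<bar>u x - c * w x\<bar> \<le> b * w x" if x: "x \<in> space S" for x
  proof -
    define r where "r = u x / w x"
    have ub: "(r - b) * w y \<le> u y" "u y \<le> (r + b) * w y" if "y \<in> space S" for y
    proof -
      have "r - b \<le> u y / w y" "u y / w y \<le> r + b"
        using u_osc[OF x that] by (auto simp: r_def)
      then show "(r - b) * w y \<le> u y" "u y \<le> (r + b) * w y"
        using w_pos[OF that] by (auto simp: pos_le_divide_eq pos_divide_le_eq)
    qed
    \<comment> \<open>\<open>\<nu>_bounds\<close> asks for a bound on both sides even when only one
      is of interest; this crude estimate supplies the other.\<close>
    have bnd: "\<bar>s * u y + t * w y\<bar> \<le> \<bar>s\<bar> * (q * w y0 * (\<bar>u y0 / w y0\<bar> + b)) + \<bar>t\<bar> * (q * w y0)" if "y \<in> space S" for s t y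
      using mult_left_mono[OF u_abs[OF that], of "\<bar>s\<bar>"] mult_left_mono[OF w_abs[OF that], of "\<bar>t\<bar>"]
        abs_triangle_ineq[of "s * u y" "t * w y"] by (simp add: abs_mult)
    have ub': "0 \<le> 1 * u y + (- (r - b)) * w y" "0 \<le> (- 1) * u y + (r + b) * w y" if "y \<in> space S" for y
      using ub[OF that] by (auto simp: algebra_simps)
    have "0 \<le> \<nu> (\<lambda>y. 1 * u y + (- (r - b)) * w y)"
      by (rule \<nu>_bounds(1)[OF _ ub'(1) order_trans[OF abs_ge_self bnd]]) measurable
    then have 1: "(r - b) * \<nu> w \<le> \<nu> u" unfolding lin by (simp add: algebra_simps)
    have "0 \<le> \<nu> (\<lambda>y. (- 1) * u y + (r + b) * w y)"
      by (rule \<nu>_bounds(1)[OF _ ub'(2) order_trans[OF abs_ge_self bnd]]) measurable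
    then have 2: "\<nu> u \<le> (r + b) * \<nu> w" unfolding lin by (simp add: algebra_simps)
    have "\<bar>r - c\<bar> \<le> b"
      using 1 2 \<nu>w unfolding c_def by (auto simp: abs_le_iff field_simps)
    then have "w x * \<bar>r - c\<bar> \<le> w x * b"
      using w_pos[OF x] by simp
    moreover have "u x - c * w x = w x * (r - c)"
      using w_pos[OF x] by (simp add: r_def field_simps)
    ultimately show ?thesis
      using w_pos[OF x] by (simp add: abs_mult mult.commute)
  qed
  have h_abs: "\<bar>h x\<bar> \<le> q * b" if "x \<in> space S" for x
  proof -
    have "\<bar>u x - c * w x\<bar> \<le> b * (q * \<nu> w)"
      using u_c[OF that] mult_left_mono[OF \<nu>w_upper[OF that] b] by linarith
    then show ?thesis
      using \<nu>w by (simp add: h_def field_simps)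
  qed
  have h_le: "- (q * b) \<le> h x" "h x \<le> q * b" if "x \<in> space S" for x
    using h_abs[OF that] by (auto simp: abs_le_iff)
  have \<nu>g: "\<nu> g = 1" and \<nu>h: "\<nu> h = 0"
  proof -
    have "g = (\<lambda>x. 0 * u x + (1 / \<nu> w) * w x)" "h = (\<lambda>x. (1 / \<nu> w) * u x + (- c / \<nu> w) * w x)"
      by (auto simp: g_def h_def diff_divide_distrib)
    then show "\<nu> g = 1" "\<nu> h = 0"
      using \<nu>w lin[of 0 "1 / \<nu> w"] lin[of "1 / \<nu> w" "- c / \<nu> w"] by (auto simp: c_def)
  qed
  define A where "A x = \<mu> g x - 1" for x
  define B where "B x = \<mu> h x" for x
  define E where "E x = - (A x * B x / \<mu> g x)" for x
  have [measurable]: "\<mu> g \<in> borel_measurable (PiM J M)" "B \<in> borel_measurable (PiM J M)"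
    unfolding B_def by (intro \<mu>_meas gh_meas)+
  have [measurable]: "A \<in> borel_measurable (PiM J M)" "E \<in> borel_measurable (PiM J M)"
    unfolding A_def E_def by measurable
  have \<mu>g: "1 / q \<le> \<mu> g x" "\<mu> g x \<le> q" if "x \<in> space (PiM J M)" for x
    using \<mu>_bounds[OF that, of "1 / q" g q] g_bounds by auto
  have A_abs: "\<bar>A x\<bar> \<le> q" if "x \<in> space (PiM J M)" for x
    using \<mu>g[OF that] q by (simp add: A_def abs_le_iff) (smt (verit) divide_nonneg_nonneg)
  have B_abs: "\<bar>B x\<bar> \<le> q * b" if "x \<in> space (PiM J M)" for x
    using \<mu>_bounds[OF that, of "- (q * b)" h "q * b"] h_le by (simp add: B_def abs_le_iff minus_le_iff)
  have R_ratio: "R x = B x / \<mu> g x" if x: "x \<in> space (PiM J M)" for x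
  proof -
    have "0 < \<mu> g x" using \<mu>g(1)[OF x] q by (smt (verit) divide_pos_pos)
    moreover have "\<mu> g x = \<mu> w x / \<nu> w"
      by (simp add: \<mu>_def g_def sum_divide_distrib mult.commute)
    ultimately have w0: "0 < \<mu> w x" using \<nu>w by (simp add: zero_less_divide_iff)
    have "B x = (\<mu> u x - c * \<mu> w x) / \<nu> w"
      by (simp add: B_def \<mu>_def h_def sum_divide_distrib[symmetric] sum_subtractf sum_distrib_left[symmetric] diff_divide_distrib mult.commute[of "\<nu> w"])
    then have "B x / \<mu> g x = \<mu> u x / \<mu> w x - c"
      unfolding \<open>\<mu> g x = \<mu> w x / \<nu> w\<close> using w0 \<nu>w by (simp add: field_simps)
    moreover have "R x = \<mu> u x / \<mu> w x - c"
      using n by (simp add: R_def \<mu>_def c_def \<nu>_def)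
    ultimately show ?thesis by simp
  qed
  have R_eq: "R x = E x + B x" if x: "x \<in> space (PiM J M)" for x
  proof -
    have "\<mu> g x \<noteq> 0" using \<mu>g(1)[OF x] q by (smt (verit) divide_pos_pos)
    then show ?thesis
      unfolding R_ratio[OF x] E_def A_def by (simp add: field_simps)
  qed
  \<comment> \<open>Dividing by \<open>\<mu> g\<close>, which is at least \<open>1 / q\<close>,
    costs one factor \<open>q\<close>.\<close>
  have E_abs: "\<bar>E x\<bar> \<le> q * \<bar>A x * B x\<bar>" if x: "x \<in> space (PiM J M)" for x
  proof -
    have p: "0 < 1 / q" using q by simp
    have "\<bar>E x\<bar> = \<bar>A x * B x\<bar> / \<mu> g x"
      using less_le_trans[OF p \<mu>g(1)[OF x]] by (simp add: E_def)
    also have "\<dots> \<le> \<bar>A x * B x\<bar> / (1 / q)"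
      by (intro divide_left_mono mult_pos_pos \<mu>g(1)[OF x] less_le_trans[OF p \<mu>g(1)[OF x]] p) simp
    finally show ?thesis by (simp add: mult.commute)
  qed
  have pow_int: "integrable (PiM J M) (\<lambda>x. X x ^ j)"
    if "X \<in> borel_measurable (PiM J M)" "\<And>x. x \<in> space (PiM J M) \<Longrightarrow> \<bar>X x\<bar> \<le> m" for X :: "_ \<Rightarrow> real" and m j
    using that by (intro pr.integrable_const_bound[of _ "m ^ j"] AE_I2) (auto simp: power_abs intro!: power_mono)
  have E_bound: "\<bar>E x\<bar> \<le> q * (q * (q * b))" if x: "x \<in> space (PiM J M)" for x
  proof -
    have "\<bar>A x * B x\<bar> \<le> q * (q * b)"
      unfolding abs_mult using A_abs[OF x] B_abs[OF x] q b by (intro mult_mono) auto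
    then show ?thesis using E_abs[OF x] q by (smt (verit) mult_left_mono)
  qed
  have A_mom: "(\<integral>x. \<bar>A x\<bar> ^ j \<partial>PiM J M) \<le> (bconst j * q / sqrt ?n) ^ j" for j
  proof -
    \<comment> \<open>The lower end 0 is used instead of \<open>1 / q\<close>, so that the width of
      the interval is simply \<open>q\<close>.\<close>
    have "(\<integral>x. \<bar>\<mu> g x - \<nu> g\<bar> ^ j \<partial>PiM J M) \<le> (bconst j * (q - 0) / sqrt ?n) ^ j"
      unfolding \<mu>_def \<nu>_def
    proof (rule centered_average_moment_le[OF J meas_M[OF gh_meas(1)]])
      fix i x assume "i \<in> J" "x \<in> space (M i)"
      then have "x \<in> space S" using space_M by simp
      then show "0 \<le> g x" "g x \<le> q"
        using g_bounds[of x] w_pos[of x] \<nu>w by (auto simp: g_def)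
    qed (use q in auto)
    then show ?thesis unfolding A_def \<nu>g by simp
  qed
  have B_mom: "(\<integral>x. \<bar>B x\<bar> ^ j \<partial>PiM J M) \<le> (bconst j * (2 * q * b) / sqrt ?n) ^ j" for j
  proof -
    have "(\<integral>x. \<bar>\<mu> h x - \<nu> h\<bar> ^ j \<partial>PiM J M) \<le> (bconst j * (q * b - - (q * b)) / sqrt ?n) ^ j"
      unfolding \<mu>_def \<nu>_def
    proof (rule centered_average_moment_le[OF J meas_M[OF gh_meas(2)]])
      fix i x assume "i \<in> J" "x \<in> space (M i)"
      then have "x \<in> space S" using space_M by simp
      then show "- (q * b) \<le> h x" "h x \<le> q * b" by (rule h_le)+
    qed (use q b in auto)
    then show ?thesis unfolding B_def \<nu>h by (simp add: mult_ac)
  qed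
  have E_mom: "(\<integral>x. \<bar>E x\<bar> ^ j \<partial>PiM J M) \<le> (bconst (2 * j) ^ 2 * (2 * q ^ 3 * b) / ?n) ^ j" for j
  proof -
    have "(\<integral>x. \<bar>E x\<bar> ^ j \<partial>PiM J M) \<le> (\<integral>x. q ^ j * \<bar>A x ^ j * B x ^ j\<bar> \<partial>PiM J M)"
    proof (rule integral_mono')
      have "\<bar>(A x * B x) ^ j\<bar> \<le> (q * (q * b)) ^ j" if "x \<in> space (PiM J M)" for x
        unfolding power_abs abs_mult using A_abs[OF that] B_abs[OF that] q b by (intro power_mono mult_mono) auto
      then show "integrable (PiM J M) (\<lambda>x. q ^ j * \<bar>A x ^ j * B x ^ j\<bar>)"
        by (intro integrable_mult_right pr.integrable_const_bound[of _ "(q * (q * b)) ^ j"] AE_I2)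
          (auto simp: power_mult_distrib)
      show "\<bar>E x\<bar> ^ j \<le> q ^ j * \<bar>A x ^ j * B x ^ j\<bar>" if "x \<in> space (PiM J M)" for x
        using power_mono[OF E_abs[OF that], of j] by (simp add: power_mult_distrib power_abs abs_mult)
    qed (use q in auto)
    also have "\<dots> = q ^ j * (\<integral>x. \<bar>A x ^ j * B x ^ j\<bar> \<partial>PiM J M)"
      by simp
    \<comment> \<open>\<open>A\<close> and \<open>B\<close> are functions of the same sample and not
      independent. Cauchy-Schwarz passes to their moments of order \<open>2 * j\<close>; the two
      factors \<open>1 / sqrt ?n\<close> multiply to the rate \<open>1 / ?n\<close>.\<close>
    also have "(\<integral>x. \<bar>A x ^ j * B x ^ j\<bar> \<partial>PiM J M)
        \<le> sqrt ((\<integral>x. (A x ^ j)\<^sup>2 \<partial>PiM J M) * (\<integral>x. (B x ^ j)\<^sup>2 \<partial>PiM J M))"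
      using pow_int[OF _ A_abs] pow_int[OF _ B_abs]
      by (intro integral_abs_mult_le) (auto simp: power_mult[symmetric])
    also have "\<dots> \<le> sqrt ((bconst (2 * j) * q / sqrt ?n) ^ (2 * j) * (bconst (2 * j) * (2 * q * b) / sqrt ?n) ^ (2 * j))"
    proof (intro real_sqrt_le_mono mult_mono)
      have sq: "(z ^ j)\<^sup>2 = \<bar>z\<bar> ^ (2 * j)" for z :: real
        unfolding power_even_eq[symmetric] by (simp add: power_even_abs)
      show "(\<integral>x. (A x ^ j)\<^sup>2 \<partial>PiM J M) \<le> (bconst (2 * j) * q / sqrt ?n) ^ (2 * j)"
        unfolding sq by (rule A_mom)
      show "(\<integral>x. (B x ^ j)\<^sup>2 \<partial>PiM J M) \<le> (bconst (2 * j) * (2 * q * b) / sqrt ?n) ^ (2 * j)"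
        unfolding sq by (rule B_mom)
    qed auto
    also have "\<dots> = (bconst (2 * j) * q / sqrt ?n * (bconst (2 * j) * (2 * q * b) / sqrt ?n)) ^ j"
    proof -
      have "0 \<le> bconst (2 * j) * q / sqrt ?n * (bconst (2 * j) * (2 * q * b) / sqrt ?n)"
        using bconst_nonneg[of "2 * j"] q b by (intro mult_nonneg_nonneg divide_nonneg_nonneg) auto
      then show ?thesis
        by (simp only: power_mult_distrib[symmetric] power_even_eq real_sqrt_abs abs_of_nonneg zero_le_power)
    qed
    also have "q ^ j * \<dots> = (bconst (2 * j) ^ 2 * (2 * q ^ 3 * b) / ?n) ^ j"
      unfolding power_mult_distrib[symmetric] using n
      by (intro arg_cong[where f = "\<lambda>t. t ^ j"]) (simp add: power2_eq_square power3_eq_cube field_simps)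
    finally show ?thesis using q by simp
  qed
  have R_int: "(\<integral>x. F (R x) \<partial>PiM J M) = (\<integral>x. F (E x + B x) \<partial>PiM J M)" for F :: "real \<Rightarrow> real"
    using R_eq by (intro Bochner_Integration.integral_cong) auto
  have "integrable (PiM J M) (\<lambda>x. \<bar>E x\<bar> ^ k)" "integrable (PiM J M) (\<lambda>x. \<bar>B x\<bar> ^ k)"
    by (rule pow_int; use E_bound B_abs in force)+
  then show "(\<integral>x. \<bar>R x\<bar> ^ k \<partial>PiM J M)
      \<le> (bconst (2 * k) ^ 2 * (2 * q ^ 3 * b) / ?n + bconst k * (2 * q * b) / sqrt ?n) ^ k"
    unfolding R_int[of "\<lambda>t. \<bar>t\<bar> ^ k"]
    using E_mom B_mom q b bconst_nonneg
    by (intro integral_abs_add_power_le) auto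
  show "\<bar>\<integral>x. R x \<partial>PiM J M\<bar> \<le> 2 * q ^ 3 * b / ?n"
  proof -
    have "integrable (PiM J M) (\<lambda>x. E x ^ 1)" "integrable (PiM J M) (\<lambda>x. B x ^ 1)"
      by (rule pow_int; use E_bound B_abs in force)+
    then have EI: "integrable (PiM J M) E" and BI: "integrable (PiM J M) B"
      by simp_all
    have hI: "integrable (PiM J M) (\<lambda>x. h (x i))" if "i \<in> J" for i
      using that h_abs meas_M[OF gh_meas(2) that] space_M[OF that]
      by (intro pr.integrable_const_bound[of _ "q * b"] AE_I2) (auto simp: space_PiM PiE_def Pi_def)
    have "(\<integral>x. B x \<partial>PiM J M) = \<nu> h"
      unfolding B_def \<mu>_def \<nu>_def using hI J meas_M[OF gh_meas(2)]
      by (simp add: integral_PiM_component)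
    then have "(\<integral>x. R x \<partial>PiM J M) = (\<integral>x. E x \<partial>PiM J M)"
      using R_int[of "\<lambda>t. t"] EI BI \<nu>h by simp
    also have "\<bar>\<dots>\<bar> \<le> (\<integral>x. \<bar>E x\<bar> ^ 1 \<partial>PiM J M)"
      using integral_abs_bound[of "PiM J M" E] by simp
    also have "\<dots> \<le> (bconst (2 * 1) ^ 2 * (2 * q ^ 3 * b) / ?n) ^ 1"
      by (rule E_mom)
    \<comment> \<open>The bias is the case of exponent 1 of the remainder estimate, where the
      constant is 1.\<close>
    also have "bconst (2 * 1) ^ 2 = 1"
      using bconst_even_power[of 1] by (simp add: even_const_def)
    finally show ?thesis by simp
  qed
  show "\<bar>R x\<bar> \<le> b" if x: "x \<in> space (PiM J M)" for x
  proof -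
    \<comment> \<open>Pointwise \<open>b * g\<close> dominates both \<open>h\<close> and
      \<open>- h\<close>, and averaging keeps this. The resulting bound on \<open>R\<close> is
      deterministic and later provides integrability.\<close>
    have "0 \<le> \<mu> (\<lambda>y. b * g y - h y) x" "0 \<le> \<mu> (\<lambda>y. b * g y + h y) x"
    proof -
      have "\<bar>h y\<bar> \<le> b * g y" if "y \<in> space S" for y
        using u_c[OF that] \<nu>w by (simp add: h_def g_def divide_right_mono)
      moreover have "b * g y \<le> b * q" if "y \<in> space S" for y
        using g_bounds[OF that] b by (intro mult_left_mono) auto
      ultimately show "0 \<le> \<mu> (\<lambda>y. b * g y - h y) x" "0 \<le> \<mu> (\<lambda>y. b * g y + h y) x"
        by (intro \<mu>_bounds(1)[OF x, of 0 _ "2 * (b * q)"]; fastforce simp: abs_le_iff)+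
    qed
    then have "\<bar>B x\<bar> \<le> b * \<mu> g x"
      by (simp add: \<mu>_def B_def sum.distrib sum_subtractf sum_distrib_left[symmetric] abs_le_iff diff_divide_distrib add_divide_distrib)
    moreover have "0 < \<mu> g x" using \<mu>g(1)[OF x] q by (smt (verit) divide_pos_pos)
    ultimately show ?thesis
      unfolding R_ratio[OF x] by (simp add: pos_divide_le_eq)
  qed
qed

section \<open>Selection and mutation kernels\<close>

lemma integral_bind_bounded:
  fixes h :: "'b \<Rightarrow> real"
  assumes M: "prob_space M" and K: "K \<in> M \<rightarrow>\<^sub>M prob_algebra N"
    and h: "h \<in> borel_measurable N" "\<And>y. y \<in> space N \<Longrightarrow> \<bar>h y\<bar> \<le> B"
  shows "(\<integral>y. h y \<partial>(M \<bind> K)) = (\<integral>x. (\<integral>y. h y \<partial>K x) \<partial>M)"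
proof -
  interpret M: prob_space M by fact
  note K' = measurable_prob_algebraD[OF K]
  have "M \<bind> K = join (distr M (subprob_algebra N) K)"
    by (rule bind_nonempty''[OF K' M.not_empty])
  also have "(\<integral>y. h y \<partial>\<dots>) = (\<integral>L. integral\<^sup>L L h \<partial>distr M (subprob_algebra N) K)"
  proof (rule integral_join[OF h])
    show "finite_measure (distr M (subprob_algebra N) K)"
      using M.prob_space_distr[OF K'] by (rule prob_space.finite_measure)
    show "AE L in distr M (subprob_algebra N) K. emeasure L (space L) \<le> ennreal 1"
      by (intro AE_I2) (auto simp: space_subprob_algebra subprob_space.emeasure_space_le_1)
  qed auto
  also have "\<dots> = (\<integral>x. (\<integral>y. h y \<partial>K x) \<partial>M)"
    using K' h by (subst integral_distr) (auto intro: integral_measurable_subprob_algebra)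
  finally show ?thesis .
qed

text \<open>Rectangles generate the product and are stable under intersection, so measurability is
  checked on them; there the product measure is a finite product of measurable functions of
  \<open>x\<close>.\<close>

lemma PiM_kernel_measurable:
  fixes K :: "'i \<Rightarrow> 'x \<Rightarrow> 'a measure"
  assumes I: "finite I" and K: "\<And>i. i \<in> I \<Longrightarrow> K i \<in> L \<rightarrow>\<^sub>M prob_algebra (N i)"
  shows "(\<lambda>x. PiM I (\<lambda>i. K i x)) \<in> L \<rightarrow>\<^sub>M prob_algebra (PiM I N)"
proof (rule measurable_prob_algebra_generated[OF sets_PiM Int_stable_prod_algebra prod_algebra_sets_into_space])
  have Kx: "prob_space (K i x)" "sets (K i x) = sets (N i)" if "x \<in> space L" "i \<in> I" for i x
    using measurable_space[OF K[OF that(2)] that(1)] by (auto simp: space_prob_algebra)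
  fix x assume x: "x \<in> space L"
  show "prob_space (PiM I (\<lambda>i. K i x))"
    using Kx[OF x] by (intro prob_space_PiM)
  show "sets (PiM I (\<lambda>i. K i x)) = sets (PiM I N)"
    using Kx[OF x] by (intro sets_PiM_cong) auto
next
  fix A assume "A \<in> prod_algebra I N"
  then obtain X where A: "A = Pi\<^sub>E I X" and X: "\<And>i. i \<in> I \<Longrightarrow> X i \<in> sets (N i)"
    unfolding prod_algebra_eq_finite[OF I] by auto
  have "emeasure (PiM I (\<lambda>i. K i x)) A = (\<Prod>i\<in>I. emeasure (K i x) (X i))" if x: "x \<in> space L" for x
  proof -
    \<comment> \<open>A product of probability measures is required at every index, while the
      hypotheses speak only of \<open>I\<close>; outside \<open>I\<close> a Dirac mass is put
      in.\<close>
    define K' where "K' i = (if i \<in> I then K i x else return (count_space UNIV) undefined)" for i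
    have Kx: "prob_space (K i x)" "sets (K i x) = sets (N i)" if "i \<in> I" for i
      using measurable_space[OF K[OF that] x] by (auto simp: space_prob_algebra)
    interpret product_prob_space K' I
      by (rule product_prob_spaceI) (auto simp: K'_def Kx intro: prob_space_return)
    have "PiM I (\<lambda>i. K i x) = PiM I K'"
      by (intro PiM_cong) (auto simp: K'_def)
    then have "emeasure (PiM I (\<lambda>i. K i x)) A = (\<Prod>i\<in>I. emeasure (K' i) (X i))"
      unfolding A using X I by (simp add: emeasure_PiM K'_def Kx)
    then show ?thesis by (simp add: K'_def)
  qed
  moreover have "(\<lambda>x. \<Prod>i\<in>I. emeasure (K i x) (X i)) \<in> borel_measurable L"
    using X by (intro borel_measurable_prod_ennreal measurable_compose[OF measurable_prob_algebraD[OF K] measurable_emeasure_subprob_algebra]) auto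
  ultimately show "(\<lambda>x. emeasure (PiM I (\<lambda>i. K i x)) A) \<in> borel_measurable L"
    by (simp cong: measurable_cong)
qed

text \<open>\<open>emp\<close> is given only by its values on sets. Recognising it as the law of a
  uniformly drawn particle supplies countable additivity and its integrals.\<close>

lemma emp_eq_distr:
  assumes "\<And>i. i < N \<Longrightarrow> x i \<in> space S" "0 < N"
  shows "emp S N x = distr (uniform_count_measure {..<N}) S x"
proof -
  let ?D = "distr (uniform_count_measure {..<N}) S x"
  have x: "x \<in> uniform_count_measure {..<N} \<rightarrow>\<^sub>M S"
    using assms by (auto simp: measurable_def space_uniform_count_measure sets_uniform_count_measure)
  have "?D = measure_of (space S) (sets S) (emeasure ?D)"
    using measure_of_of_measure[of ?D] by simp
  also have "\<dots> = emp S N x"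
    unfolding emp_def
  proof (rule measure_of_eq[OF sets.space_closed])
    fix A assume "A \<in> sigma_sets (space S) (sets S)"
    then have A: "A \<in> sets S" by (simp add: sets.sigma_sets_eq)
    have "x -` A \<inter> {..<N} = {i \<in> {..<N}. x i \<in> A}" by auto
    then show "emeasure ?D A = ennreal (real (card {i \<in> {..<N}. x i \<in> A}) / real N)"
      using x A by (simp add: emeasure_distr space_uniform_count_measure)
        (subst emeasure_uniform_count_measure; auto)
  qed
  finally show ?thesis ..
qed

lemma prob_space_emp:
  assumes "\<And>i. i < N \<Longrightarrow> x i \<in> space S" "0 < N"
  shows "prob_space (emp S N x)" "sets (emp S N x) = sets S"
proof -
  have x: "x \<in> uniform_count_measure {..<N} \<rightarrow>\<^sub>M S"
    using assms by (auto simp: measurable_def space_uniform_count_measure sets_uniform_count_measure)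
  have eq: "emp S N x = distr (uniform_count_measure {..<N}) S x"
    using assms by (rule emp_eq_distr)
  show "prob_space (emp S N x)"
    unfolding eq
    by (intro prob_space.prob_space_distr[OF _ x] prob_space_uniform_count_measure) (use assms in auto)
  show "sets (emp S N x) = sets S"
    unfolding eq by simp
qed

lemma integral_emp:
  fixes h :: "'a \<Rightarrow> real"
  assumes "\<And>i. i < N \<Longrightarrow> x i \<in> space S" "0 < N" "h \<in> borel_measurable S"
  shows "(\<integral>y. h y \<partial>emp S N x) = (\<Sum>i<N. h (x i)) / real N"
proof -
  have x: "x \<in> uniform_count_measure {..<N} \<rightarrow>\<^sub>M S"
    using assms by (auto simp: measurable_def space_uniform_count_measure sets_uniform_count_measure)
  have eq: "emp S N x = distr (uniform_count_measure {..<N}) S x"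
    using assms by (intro emp_eq_distr)
  show ?thesis
    unfolding eq using x assms(3)
    by (simp add: integral_distr integral_uniform_count_measure)
qed

section \<open>Reweighting, selection and mutation at a fixed probability measure\<close>

context
  fixes G :: "'a \<Rightarrow> real" and \<mu> S :: "'a measure"
  assumes \<mu>: "prob_space \<mu>" and sets_\<mu>: "sets \<mu> = sets S"
    and G: "G \<in> borel_measurable S" "\<And>x. x \<in> space S \<Longrightarrow> 0 < G x \<and> G x < 1"
begin

private lemma space_\<mu>: "space \<mu> = space S"
  using sets_\<mu> by (rule sets_eq_imp_space_eq)

private lemma G_\<mu>: "G \<in> borel_measurable \<mu>"
  using G(1) measurable_cong_sets[OF sets_\<mu> refl] by auto

lemma integral_potential_pos: "0 < (\<integral>y. G y \<partial>\<mu>)" and integrable_potential: "integrable \<mu> G"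
proof -
  interpret prob_space \<mu> by (rule \<mu>)
  show int: "integrable \<mu> G"
    using G G_\<mu> by (intro integrable_const_bound[of _ 1] AE_I2) (auto simp: space_\<mu> less_imp_le)
  have "\<not> (AE y in \<mu>. G y = 0)"
  proof
    assume "AE y in \<mu>. G y = 0"
    moreover have "AE y in \<mu>. G y \<noteq> 0" using G by (intro AE_I2) (force simp: space_\<mu>)
    ultimately have "AE y in \<mu>. False" by eventually_elim simp
    then show False by simp
  qed
  moreover have nonneg: "AE y in \<mu>. 0 \<le> G y"
    using G by (intro AE_I2) (simp add: space_\<mu> less_imp_le)
  ultimately have "(\<integral>y. G y \<partial>\<mu>) \<noteq> 0"
    using integral_nonneg_eq_0_iff_AE[OF int nonneg] by simp
  then show "0 < (\<integral>y. G y \<partial>\<mu>)"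
    using integral_nonneg_AE[OF nonneg] by simp
qed

lemma sets_Psi: "sets (Psi G \<mu>) = sets S"
  by (simp add: Psi_def sets_\<mu>)

lemma integral_Psi:
  fixes h :: "'a \<Rightarrow> real"
  assumes "h \<in> borel_measurable S"
  shows "(\<integral>y. h y \<partial>Psi G \<mu>) = (\<integral>y. G y * h y \<partial>\<mu>) / (\<integral>y. G y \<partial>\<mu>)"
proof -
  have "h \<in> borel_measurable \<mu>"
    using assms measurable_cong_sets[OF sets_\<mu> refl] by auto
  then have "(\<integral>y. h y \<partial>Psi G \<mu>) = (\<integral>y. (G y / (\<integral>y. G y \<partial>\<mu>)) *\<^sub>R h y \<partial>\<mu>)"
    unfolding Psi_def using G G_\<mu> integral_potential_pos
    by (intro integral_density) (auto simp: space_\<mu> less_imp_le)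
  then show ?thesis by simp
qed

lemma prob_space_Psi: "prob_space (Psi G \<mu>)"
proof
  have "emeasure (Psi G \<mu>) (space (Psi G \<mu>)) = (\<integral>\<^sup>+y. ennreal (G y / (\<integral>y. G y \<partial>\<mu>)) \<partial>\<mu>)"
    unfolding Psi_def using G_\<mu> by (simp add: emeasure_density nn_integral_set_ennreal[symmetric] cong: nn_integral_cong)
  also have "\<dots> = ennreal (\<integral>y. G y / (\<integral>y. G y \<partial>\<mu>) \<partial>\<mu>)"
    using G integral_potential_pos integrable_potential
    by (intro nn_integral_eq_integral AE_I2) (auto simp: space_\<mu> less_imp_le)
  finally show "emeasure (Psi G \<mu>) (space (Psi G \<mu>)) = 1"
    using integral_potential_pos by simp
qed

text \<open>Selection as a coin toss: with probability \<open>G x\<close> the particle stays at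
  \<open>x\<close>, otherwise it is redrawn from \<open>Psi G \<mu>\<close>. As a mixture of two
  probability measures it inherits their measure properties.\<close>

lemma Sel_eq_bind:
  assumes x: "x \<in> space S"
  shows "Sel G \<mu> x = measure_pmf (bernoulli_pmf (G x)) \<bind> (\<lambda>b. if b then return S x else Psi G \<mu>)"
    (is "_ = ?B")
proof -
  let ?k = "\<lambda>b. if b then return S x else Psi G \<mu>"
  have k: "?k \<in> measure_pmf (bernoulli_pmf (G x)) \<rightarrow>\<^sub>M subprob_algebra S"
    using x prob_space_return[OF x] prob_space_Psi
    by (auto simp: space_subprob_algebra sets_Psi prob_space_imp_subprob_space)
  have sets_B: "sets ?B = sets S"
    using k by (subst sets_bind_measurable[of _ _ S]) auto
  have "?B = measure_of (space ?B) (sets ?B) (emeasure ?B)"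
    by (rule measure_of_of_measure[symmetric])
  also have "\<dots> = Sel G \<mu> x"
    unfolding Sel_def sets_B sets_eq_imp_space_eq[OF sets_B] sets_\<mu> space_\<mu>
  proof (rule measure_of_eq[OF sets.space_closed])
    fix A assume "A \<in> sigma_sets (space S) (sets S)"
    then have A: "A \<in> sets S" by (simp add: sets.sigma_sets_eq)
    have "emeasure ?B A = (\<integral>\<^sup>+b. emeasure (?k b) A \<partial>measure_pmf (bernoulli_pmf (G x)))"
      using k A by (intro emeasure_bind) auto
    also have "\<dots> = emeasure (return S x) A * ennreal (G x) + emeasure (Psi G \<mu>) A * ennreal (1 - G x)"
      using G(2)[OF x] by (subst nn_integral_bernoulli_pmf) auto
    finally show "emeasure ?B A = ennreal (G x) * indicator A x + ennreal (1 - G x) * emeasure (Psi G \<mu>) A"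
      using A by (simp add: mult.commute)
  qed
  finally show ?thesis ..
qed

lemma Sel_kernel:
  assumes x: "x \<in> space S"
  shows "sets (Sel G \<mu> x) = sets S" "prob_space (Sel G \<mu> x)"
    and integral_Sel: "\<And>h B. h \<in> borel_measurable S \<Longrightarrow> (\<And>y. y \<in> space S \<Longrightarrow> \<bar>h y\<bar> \<le> B) \<Longrightarrow>
      (\<integral>y. h y \<partial>Sel G \<mu> x) = G x * h x + (1 - G x) * ((\<integral>y. G y * h y \<partial>\<mu>) / (\<integral>y. G y \<partial>\<mu>))"
proof -
  let ?k = "\<lambda>b. if b then return S x else Psi G \<mu>"
  have k: "?k \<in> measure_pmf (bernoulli_pmf (G x)) \<rightarrow>\<^sub>M prob_algebra S"
    using x prob_space_return[OF x] prob_space_Psi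
    by (auto simp: space_prob_algebra sets_Psi)
  have b: "measure_pmf (bernoulli_pmf (G x)) \<in> space (prob_algebra (measure_pmf (bernoulli_pmf (G x))))"
    by (auto simp: space_prob_algebra measure_pmf.prob_space_axioms)
  show "sets (Sel G \<mu> x) = sets S" "prob_space (Sel G \<mu> x)"
    unfolding Sel_eq_bind[OF x] using sets_bind'[OF b k] prob_space_bind'[OF b k] by auto
  fix h :: "'a \<Rightarrow> real" and B assume h: "h \<in> borel_measurable S" "\<And>y. y \<in> space S \<Longrightarrow> \<bar>h y\<bar> \<le> B"
  have "(\<integral>y. h y \<partial>Sel G \<mu> x) = (\<integral>b. (\<integral>y. h y \<partial>?k b) \<partial>measure_pmf (bernoulli_pmf (G x)))"
    unfolding Sel_eq_bind[OF x] by (rule integral_bind_bounded[OF measure_pmf.prob_space_axioms k h])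
  also have "\<dots> = (\<integral>y. h y \<partial>return S x) * G x + (\<integral>y. h y \<partial>Psi G \<mu>) * (1 - G x)"
    using G(2)[OF x] by (subst integral_bernoulli_pmf) auto
  finally show "(\<integral>y. h y \<partial>Sel G \<mu> x) = G x * h x + (1 - G x) * ((\<integral>y. G y * h y \<partial>\<mu>) / (\<integral>y. G y \<partial>\<mu>))"
    using h x by (simp add: integral_return integral_Psi mult.commute)
qed

lemma Kmu_kernel:
  fixes S' :: "'a measure"
  assumes x: "x \<in> space S" and M: "M \<in> S \<rightarrow>\<^sub>M prob_algebra S'"
  shows "sets (Kmu G M \<mu> x) = sets S'" "prob_space (Kmu G M \<mu> x)"
    and integral_Kmu: "\<And>h B. h \<in> borel_measurable S' \<Longrightarrow> (\<And>y. y \<in> space S' \<Longrightarrow> \<bar>h y\<bar> \<le> B) \<Longrightarrow>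
      (\<integral>y. h y \<partial>Kmu G M \<mu> x) = G x * (\<integral>z. h z \<partial>M x)
        + (1 - G x) * ((\<integral>y. G y * (\<integral>z. h z \<partial>M y) \<partial>\<mu>) / (\<integral>y. G y \<partial>\<mu>))"
proof -
  have s: "Sel G \<mu> x \<in> space (prob_algebra S)"
    using Sel_kernel[OF x] by (simp add: space_prob_algebra)
  show "sets (Kmu G M \<mu> x) = sets S'" "prob_space (Kmu G M \<mu> x)"
    unfolding Kmu_def using sets_bind'[OF s M] prob_space_bind'[OF s M] by auto
  fix h :: "'a \<Rightarrow> real" and B assume h: "h \<in> borel_measurable S'" "\<And>y. y \<in> space S' \<Longrightarrow> \<bar>h y\<bar> \<le> B"
  have M': "M \<in> Sel G \<mu> x \<rightarrow>\<^sub>M prob_algebra S'"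
    using M measurable_cong_sets[OF Sel_kernel(1)[OF x] refl] by auto
  have "(\<integral>y. h y \<partial>Kmu G M \<mu> x) = (\<integral>y. (\<integral>z. h z \<partial>M y) \<partial>Sel G \<mu> x)"
    unfolding Kmu_def by (rule integral_bind_bounded[OF Sel_kernel(2)[OF x] M' h])
  also have "\<dots> = G x * (\<integral>z. h z \<partial>M x)
        + (1 - G x) * ((\<integral>y. G y * (\<integral>z. h z \<partial>M y) \<partial>\<mu>) / (\<integral>y. G y \<partial>\<mu>))"
  proof (rule integral_Sel[OF x])
    show "(\<lambda>y. \<integral>z. h z \<partial>M y) \<in> borel_measurable S"
      by (rule measurable_compose[OF measurable_prob_algebraD[OF M] integral_measurable_subprob_algebra[OF h(1)]])
    show "\<bar>\<integral>z. h z \<partial>M y\<bar> \<le> B" if y: "y \<in> space S" for y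
    proof -
      have My: "prob_space (M y)" "sets (M y) = sets S'"
        using measurable_space[OF M y] by (auto simp: space_prob_algebra)
      have "h \<in> borel_measurable (M y)"
        using h(1) measurable_cong_sets[OF My(2) refl] by auto
      moreover have "- B \<le> h z" "h z \<le> B" if "z \<in> space (M y)" for z
        using h(2)[of z] that sets_eq_imp_space_eq[OF My(2)] by (auto simp: abs_le_iff)
      ultimately show ?thesis
        using prob_space.integral_in_bounds[OF My(1), of h "- B" B] by (auto simp: abs_le_iff)
    qed
  qed
  finally show "(\<integral>y. h y \<partial>Kmu G M \<mu> x) = G x * (\<integral>z. h z \<partial>M x)
        + (1 - G x) * ((\<integral>y. G y * (\<integral>z. h z \<partial>M y) \<partial>\<mu>) / (\<integral>y. G y \<partial>\<mu>))" .
qed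

end

section \<open>The limiting flow\<close>

locale particle_flow =
  fixes S :: "nat \<Rightarrow> 'a measure" and \<eta>0 :: "'a measure"
    and M :: "nat \<Rightarrow> 'a \<Rightarrow> 'a measure" and G :: "nat \<Rightarrow> 'a \<Rightarrow> real"
  assumes eta0: "\<eta>0 \<in> space (prob_algebra (S 0))"
    and kernels: "\<And>k. M (Suc k) \<in> S k \<rightarrow>\<^sub>M prob_algebra (S (Suc k))"
    and G_meas: "\<And>k. G k \<in> borel_measurable (S k)"
    and G_range: "\<And>k x. x \<in> space (S k) \<Longrightarrow> 0 < G k x \<and> G k x < 1"
    and G_ratio: "\<And>k. \<exists>c. \<forall>x\<in>space (S k). \<forall>y\<in>space (S k). G k x / G k y \<le> c"
begin

lemma kernel_prob: "x \<in> space (S k) \<Longrightarrow> prob_space (M (Suc k) x)"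
  and kernel_sets: "x \<in> space (S k) \<Longrightarrow> sets (M (Suc k) x) = sets (S (Suc k))"
  using measurable_space[OF kernels] by (auto simp: space_prob_algebra)

lemma kernel_space: "x \<in> space (S k) \<Longrightarrow> space (M (Suc k) x) = space (S (Suc k))"
  by (intro sets_eq_imp_space_eq kernel_sets)

lemma space_nonempty: "space (S k) \<noteq> {}"
proof (induction k)
  case 0
  then show ?case
    using eta0 prob_space.not_empty[of \<eta>0] sets_eq_imp_space_eq[of \<eta>0 "S 0"] by (auto simp: space_prob_algebra)
next
  case (Suc k)
  then obtain x where x: "x \<in> space (S k)" by auto
  then show ?case
    using prob_space.not_empty[OF kernel_prob[OF x]] kernel_space[OF x] by simp
qed

lemma kernel_integral_meas:
  fixes h :: "'a \<Rightarrow> real"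
  assumes "h \<in> borel_measurable (S (Suc k))"
  shows "(\<lambda>x. \<integral>y. h y \<partial>M (Suc k) x) \<in> borel_measurable (S k)"
  by (rule measurable_compose[OF measurable_prob_algebraD[OF kernels] integral_measurable_subprob_algebra[OF assms]])

lemma kernel_integral_bounds:
  fixes h :: "'a \<Rightarrow> real"
  assumes "h \<in> borel_measurable (S (Suc k))" "\<And>y. y \<in> space (S (Suc k)) \<Longrightarrow> l \<le> h y"
    "\<And>y. y \<in> space (S (Suc k)) \<Longrightarrow> h y \<le> u" "x \<in> space (S k)"
  shows "l \<le> (\<integral>y. h y \<partial>M (Suc k) x)" "(\<integral>y. h y \<partial>M (Suc k) x) \<le> u"
  using prob_space.integral_in_bounds[OF kernel_prob[OF assms(4)], of h l u] assms(1-3)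
    measurable_cong_sets[OF kernel_sets[OF assms(4)] refl, of borel] kernel_space[OF assms(4)] by auto

lemma kernel_integrable:
  fixes h :: "'a \<Rightarrow> real"
  assumes "h \<in> borel_measurable (S (Suc k))" "\<And>y. y \<in> space (S (Suc k)) \<Longrightarrow> \<bar>h y\<bar> \<le> B" "x \<in> space (S k)"
  shows "integrable (M (Suc k) x) h"
  using assms measurable_cong_sets[OF kernel_sets[OF assms(3)] refl, of borel] kernel_space[OF assms(3)]
  by (intro finite_measure.integrable_const_bound[of _ _ B] prob_space.finite_measure kernel_prob) auto

section \<open>The unnormalised semigroup, its total mass and its oscillation\<close>

lemma Qk_meas: "h \<in> borel_measurable (S (p + k)) \<Longrightarrow> Qk M G p k h \<in> borel_measurable (S p)"
proof (induction k arbitrary: p)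
  case (Suc k)
  then have "Qk M G (Suc p) k h \<in> borel_measurable (S (Suc p))" by simp
  from kernel_integral_meas[OF this] show ?case
    using G_meas[of p] by simp
qed simp

text \<open>Since \<open>G\<close> is below 1 and \<open>M\<close> is Markov, each step is
  sub-Markov and preserves the bound \<open>B\<close>.\<close>

lemma Qk_abs_le:
  assumes "h \<in> borel_measurable (S (p + k))" "\<And>y. y \<in> space (S (p + k)) \<Longrightarrow> \<bar>h y\<bar> \<le> B" "x \<in> space (S p)"
  shows "\<bar>Qk M G p k h x\<bar> \<le> B"
  using assms
proof (induction k arbitrary: p x)
  case (Suc k)
  have h: "h \<in> borel_measurable (S (Suc p + k))" using Suc.prems(1) by simp
  have le: "\<bar>Qk M G (Suc p) k h y\<bar> \<le> B" if "y \<in> space (S (Suc p))" for y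
    using that Suc.prems by (intro Suc.IH[OF h]) auto
  have "\<bar>\<integral>y. Qk M G (Suc p) k h y \<partial>M (Suc p) x\<bar> \<le> B"
    using kernel_integral_bounds[OF Qk_meas[OF h], of "- B" B x] le Suc.prems(3) by (auto simp: abs_le_iff minus_le_iff)
  moreover have "0 < G p x" "G p x < 1"
    using G_range[OF Suc.prems(3)] by auto
  ultimately have "\<bar>G p x\<bar> * \<bar>\<integral>y. Qk M G (Suc p) k h y \<partial>M (Suc p) x\<bar> \<le> 1 * B"
    by (intro mult_mono) auto
  then show ?case by (simp add: abs_mult)
qed simp

text \<open>Division by \<open>Q(1)\<close> turns this into the statement that \<open>P\<close> maps
  functions with values in \<open>[l, u]\<close> to such functions. The undivided form passes
  through the induction because each step is a positive linear operator.\<close>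

lemma Qk_sandwich:
  assumes "h \<in> borel_measurable (S (p + k))" "\<And>y. y \<in> space (S (p + k)) \<Longrightarrow> l \<le> h y"
    "\<And>y. y \<in> space (S (p + k)) \<Longrightarrow> h y \<le> u" "x \<in> space (S p)"
  shows "l * Qk M G p k (\<lambda>_. 1) x \<le> Qk M G p k h x \<and> Qk M G p k h x \<le> u * Qk M G p k (\<lambda>_. 1) x"
  using assms
proof (induction k arbitrary: p x)
  case (Suc k)
  have h: "h \<in> borel_measurable (S (Suc p + k))" using Suc.prems(1) by simp
  have x: "x \<in> space (S p)" by fact
  have hB: "\<bar>h y\<bar> \<le> max \<bar>l\<bar> \<bar>u\<bar>" if "y \<in> space (S (Suc p + k))" for y
    using Suc.prems(2)[of y] Suc.prems(3)[of y] that by auto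
  have IH: "l * Qk M G (Suc p) k (\<lambda>_. 1) y \<le> Qk M G (Suc p) k h y" "Qk M G (Suc p) k h y \<le> u * Qk M G (Suc p) k (\<lambda>_. 1) y"
    if "y \<in> space (S (Suc p))" for y
    using Suc.IH[OF h] Suc.prems that by auto
  have i1: "integrable (M (Suc p) x) (Qk M G (Suc p) k (\<lambda>_. 1))"
    by (intro kernel_integrable[of _ _ 1] Qk_meas Qk_abs_le x) auto
  have ih: "integrable (M (Suc p) x) (Qk M G (Suc p) k h)"
    by (rule kernel_integrable[OF Qk_meas[OF h] Qk_abs_le[OF h hB] x]) auto
  have "l * (\<integral>y. Qk M G (Suc p) k (\<lambda>_. 1) y \<partial>M (Suc p) x) \<le> (\<integral>y. Qk M G (Suc p) k h y \<partial>M (Suc p) x)"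
    unfolding integral_mult_right_zero[symmetric]
    using IH kernel_space[OF x] i1 ih by (intro integral_mono) auto
  moreover have "(\<integral>y. Qk M G (Suc p) k h y \<partial>M (Suc p) x) \<le> u * (\<integral>y. Qk M G (Suc p) k (\<lambda>_. 1) y \<partial>M (Suc p) x)"
    unfolding integral_mult_right_zero[symmetric]
    using IH kernel_space[OF x] i1 ih by (intro integral_mono) auto
  moreover have "0 \<le> G p x" using G_range[OF x] by auto
  ultimately show ?case
    by (auto simp: mult.left_commute[of l] mult.left_commute[of u] intro!: mult_left_mono)
qed auto

text \<open>Bounded ratios and positivity at a single point \<open>x0\<close> give the uniform bound
  \<open>G k x0 / c\<close>.\<close>

lemma G_lower: "\<exists>c>0. \<forall>x\<in>space (S k). c \<le> G k x"
proof -
  obtain x0 where x0: "x0 \<in> space (S k)" using space_nonempty by blast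
  obtain c where c: "\<And>x y. x \<in> space (S k) \<Longrightarrow> y \<in> space (S k) \<Longrightarrow> G k x / G k y \<le> c"
    using G_ratio by blast
  have pos: "0 < G k x0" using G_range[OF x0] by simp
  have "1 \<le> c" using c[OF x0 x0] pos by simp
  have "G k x0 / c \<le> G k x" if "x \<in> space (S k)" for x
    using c[OF x0 that] G_range[OF that] \<open>1 \<le> c\<close> by (simp add: field_simps)
  then show ?thesis using pos \<open>1 \<le> c\<close> by (intro exI[of _ "G k x0 / c"]) auto
qed

text \<open>A lower bound on the mass, uniform in the starting point. Together with the upper bound
  1 it shows that the supremum in \<open>qpn\<close> is over a bounded set, without which the
  supremum would not dominate the ratios.\<close>

lemma Qk_one_lower: "\<exists>c>0. \<forall>x\<in>space (S p). c \<le> Qk M G p k (\<lambda>_. 1) x"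
proof (induction k arbitrary: p)
  case (Suc k)
  obtain c where c: "0 < c" "\<And>x. x \<in> space (S (Suc p)) \<Longrightarrow> c \<le> Qk M G (Suc p) k (\<lambda>_. 1) x"
    using Suc by blast
  obtain d where d: "0 < d" "\<And>x. x \<in> space (S p) \<Longrightarrow> d \<le> G p x"
    using G_lower by blast
  have "d * c \<le> Qk M G p (Suc k) (\<lambda>_. 1) x" if x: "x \<in> space (S p)" for x
  proof -
    have "c \<le> (\<integral>y. Qk M G (Suc p) k (\<lambda>_. 1) y \<partial>M (Suc p) x)"
    proof (rule kernel_integral_bounds(1)[OF _ c(2) _ x])
      show "Qk M G (Suc p) k (\<lambda>_. 1) y \<le> 1" if "y \<in> space (S (Suc p))" for y
        using Qk_abs_le[of "\<lambda>_. 1" "Suc p" k 1 y] that by (auto simp: abs_le_iff)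
    qed (auto intro: Qk_meas)
    then show ?thesis using d(1) d(2)[OF x] c(1) by (auto intro!: mult_mono)
  qed
  then show ?case using d c by (intro exI[of _ "d * c"]) auto
qed (auto intro: exI[of _ 1])

lemma Qk_one_pos: "x \<in> space (S p) \<Longrightarrow> 0 < Qk M G p k (\<lambda>_. 1) x"
  using Qk_one_lower[of p k] by fastforce

lemma Qk_one_le: "x \<in> space (S p) \<Longrightarrow> Qk M G p k (\<lambda>_. 1) x \<le> 1"
  using Qk_abs_le[of "\<lambda>_. 1" p k 1 x] by (auto simp: abs_le_iff)

lemma Qk_one_ratio:
  assumes "x \<in> space (S p)" "y \<in> space (S p)"
  shows "Qk M G p (n - p) (\<lambda>_. 1) x \<le> qpn S M G p n * Qk M G p (n - p) (\<lambda>_. 1) y"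
proof -
  let ?w = "Qk M G p (n - p) (\<lambda>_. 1)"
  obtain c where c: "0 < c" "\<And>x. x \<in> space (S p) \<Longrightarrow> c \<le> ?w x"
    using Qk_one_lower by blast
  have "bdd_above ((\<lambda>xy. Q M G p n (\<lambda>_. 1) (fst xy) / Q M G p n (\<lambda>_. 1) (snd xy)) ` (space (S p) \<times> space (S p)))"
  proof (rule bdd_aboveI2)
    fix xy assume "xy \<in> space (S p) \<times> space (S p)"
    then have *: "fst xy \<in> space (S p)" "snd xy \<in> space (S p)" by auto
    show "Q M G p n (\<lambda>_. 1) (fst xy) / Q M G p n (\<lambda>_. 1) (snd xy) \<le> 1 / c"
      unfolding Q_def using Qk_one_le[OF *(1)] Qk_one_pos[OF *(2)] c(1) c(2)[OF *(2)] Qk_one_pos[OF *(1)]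
      by (intro frac_le) auto
  qed
  from cSUP_upper[OF _ this, of "(x, y)"] assms
  have "?w x / ?w y \<le> qpn S M G p n"
    by (simp add: qpn_def Q_def)
  then show ?thesis
    using Qk_one_pos[OF assms(2)] by (simp add: pos_divide_le_eq)
qed

lemma Osc1_bounds:
  assumes f: "f \<in> Osc1 (S n)"
  obtains l where "\<And>x. x \<in> space (S n) \<Longrightarrow> l \<le> f x" "\<And>x. x \<in> space (S n) \<Longrightarrow> f x \<le> l + 2"
proof -
  obtain y where y: "y \<in> space (S n)" using space_nonempty by blast
  \<comment> \<open>Values are compared with one reference point \<open>y\<close>, which gives width
    2 instead of 1. The sharp width is irrelevant, as the interval serves only to show
    boundedness.\<close>
  have "f y - 1 \<le> f x \<and> f x \<le> f y - 1 + 2" if "x \<in> space (S n)" for x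
    using f y that by (fastforce simp: Osc1_def abs_le_iff)
  then show ?thesis
    by (intro that[of "f y - 1"]) auto
qed

text \<open>A crude bound, uniform in \<open>f\<close>, that makes the nested suprema in
  \<open>osc\<close> and \<open>beta\<close> genuine upper bounds.\<close>

lemma P_diff_le_two:
  assumes "f \<in> Osc1 (S n)" "p \<le> n" "x \<in> space (S p)" "y \<in> space (S p)"
  shows "\<bar>P M G p n f x - P M G p n f y\<bar> \<le> 2"
proof -
  obtain l where l: "\<And>x. x \<in> space (S n) \<Longrightarrow> l \<le> f x" "\<And>x. x \<in> space (S n) \<Longrightarrow> f x \<le> l + 2"
    using Osc1_bounds[OF assms(1)] by blast
  have "l \<le> P M G p n f z \<and> P M G p n f z \<le> l + 2" if z: "z \<in> space (S p)" for z
  proof -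
    have "l * Qk M G p (n - p) (\<lambda>_. 1) z \<le> Qk M G p (n - p) f z
      \<and> Qk M G p (n - p) f z \<le> (l + 2) * Qk M G p (n - p) (\<lambda>_. 1) z"
      using assms l z by (intro Qk_sandwich) (auto simp: Osc1_def)
    then show ?thesis
      using Qk_one_pos[OF z, of "n - p"] by (simp add: P_def Q_def pos_le_divide_eq pos_divide_le_eq)
  qed
  from this[OF assms(3)] this[OF assms(4)] show ?thesis by (auto simp: abs_le_iff)
qed

lemma P_diff_le_beta:
  assumes f: "f \<in> Osc1 (S n)" and "p \<le> n" and x: "x \<in> space (S p)" and y: "y \<in> space (S p)"
  shows "\<bar>P M G p n f x - P M G p n f y\<bar> \<le> beta S M G p n"
proof -
  have osc_bdd: "bdd_above ((\<lambda>xy. \<bar>P M G p n g (fst xy) - P M G p n g (snd xy)\<bar>) ` (space (S p) \<times> space (S p)))"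
    if "g \<in> Osc1 (S n)" for g
    using P_diff_le_two[OF that \<open>p \<le> n\<close>] by (intro bdd_aboveI2[of _ _ 2]) auto
  have "osc (space (S p)) (P M G p n g) \<le> 2" if "g \<in> Osc1 (S n)" for g
    unfolding osc_def using P_diff_le_two[OF that \<open>p \<le> n\<close>] x by (intro cSUP_least) auto
  then have "bdd_above ((\<lambda>f. osc (space (S p)) (P M G p n f)) ` Osc1 (S n))"
    by (intro bdd_aboveI2[of _ _ 2])
  from cSUP_upper[OF f this] have "osc (space (S p)) (P M G p n f) \<le> beta S M G p n"
    by (simp add: beta_def)
  moreover have "\<bar>P M G p n f x - P M G p n f y\<bar> \<le> osc (space (S p)) (P M G p n f)"
    unfolding osc_def using cSUP_upper[OF _ osc_bdd[OF f], of "(x, y)"] x y by simp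
  ultimately show ?thesis by simp
qed

lemma eta_prob: "eta \<eta>0 M G n \<in> space (prob_algebra (S n))"
proof (induction n)
  case (Suc n)
  then have *: "prob_space (eta \<eta>0 M G n)" "sets (eta \<eta>0 M G n) = sets (S n)"
    by (auto simp: space_prob_algebra)
  have Psi: "Psi (G n) (eta \<eta>0 M G n) \<in> space (prob_algebra (S n))"
    using prob_space_Psi[OF * G_meas G_range] sets_Psi[OF * G_meas G_range]
    by (simp add: space_prob_algebra)
  show ?case
    using prob_space_bind'[OF Psi kernels] sets_bind'[OF Psi kernels] by (simp add: space_prob_algebra)
qed (simp add: eta0)

lemma integral_eta_Suc:
  fixes h :: "'a \<Rightarrow> real"
  assumes h: "h \<in> borel_measurable (S (Suc n))" "\<And>y. y \<in> space (S (Suc n)) \<Longrightarrow> \<bar>h y\<bar> \<le> B"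
  shows "(\<integral>y. h y \<partial>eta \<eta>0 M G (Suc n))
    = (\<integral>x. G n x * (\<integral>y. h y \<partial>M (Suc n) x) \<partial>eta \<eta>0 M G n) / (\<integral>x. G n x \<partial>eta \<eta>0 M G n)"
proof -
  have *: "prob_space (eta \<eta>0 M G n)" "sets (eta \<eta>0 M G n) = sets (S n)"
    using eta_prob[of n] by (auto simp: space_prob_algebra)
  have kernel: "M (Suc n) \<in> Psi (G n) (eta \<eta>0 M G n) \<rightarrow>\<^sub>M prob_algebra (S (Suc n))"
    using kernels measurable_cong_sets[OF sets_Psi[OF * G_meas G_range] refl] by auto
  show ?thesis
    using integral_bind_bounded[OF prob_space_Psi[OF * G_meas G_range] kernel h]
      integral_Psi[OF * G_meas G_range kernel_integral_meas[OF h(1)]] by simp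
qed

text \<open>Backward induction from \<open>p = n\<close>: one step of the flow divides both the
  numerator and the denominator by the integral of \<open>G p\<close> under \<open>eta\<close>, and
  this factor cancels. At \<open>p = 0\<close> it identifies the target value with the centre of the
  initial i.i.d. sample.\<close>

lemma eta_semigroup:
  assumes "p \<le> n" and f: "f \<in> borel_measurable (S n)" "\<And>y. y \<in> space (S n) \<Longrightarrow> \<bar>f y\<bar> \<le> B"
  shows "(\<integral>x. Qk M G p (n - p) f x \<partial>eta \<eta>0 M G p) / (\<integral>x. Qk M G p (n - p) (\<lambda>_. 1) x \<partial>eta \<eta>0 M G p)
    = (\<integral>y. f y \<partial>eta \<eta>0 M G n)"
  using \<open>p \<le> n\<close>
proof (induction p rule: inc_induct)
  case base
  then show ?case using eta_prob[of n] by (simp add: space_prob_algebra prob_space.prob_space)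
next
  case (step p)
  have nn: "n - p = Suc (n - Suc p)" using step by simp
  have *: "prob_space (eta \<eta>0 M G p)" "sets (eta \<eta>0 M G p) = sets (S p)"
    using eta_prob[of p] by (auto simp: space_prob_algebra)
  have f': "f \<in> borel_measurable (S (Suc p + (n - Suc p)))" "\<And>y. y \<in> space (S (Suc p + (n - Suc p))) \<Longrightarrow> \<bar>f y\<bar> \<le> B"
    using f step by auto
  have "(\<integral>y. Qk M G (Suc p) (n - Suc p) h y \<partial>eta \<eta>0 M G (Suc p))
      = (\<integral>x. Qk M G p (n - p) h x \<partial>eta \<eta>0 M G p) / (\<integral>x. G p x \<partial>eta \<eta>0 M G p)"
    if "h \<in> borel_measurable (S (Suc p + (n - Suc p)))" "\<And>y. y \<in> space (S (Suc p + (n - Suc p))) \<Longrightarrow> \<bar>h y\<bar> \<le> C" for h C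
    unfolding nn Qk.simps by (rule integral_eta_Suc[OF Qk_meas[OF that(1)] Qk_abs_le[OF that]])
  from this[OF f'] this[of "\<lambda>_. 1" 1] show ?case
    using step.IH integral_potential_pos[OF * G_meas G_range] by simp
qed

end

section \<open>The particle system\<close>

lemma integrable_prob_algebra:
  fixes h :: "'a \<Rightarrow> real"
  assumes "\<mu> \<in> space (prob_algebra L)" "h \<in> borel_measurable L" "\<And>x. x \<in> space L \<Longrightarrow> \<bar>h x\<bar> \<le> B"
  shows "integrable \<mu> h"
proof -
  have *: "prob_space \<mu>" "sets \<mu> = sets L"
    using assms(1) by (auto simp: space_prob_algebra)
  show ?thesis
    using assms measurable_cong_sets[OF *(2) refl, of borel] sets_eq_imp_space_eq[OF *(2)]
    by (intro finite_measure.integrable_const_bound[OF prob_space.finite_measure[OF *(1)], of _ B]) auto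
qed

lemma abs_integral_prob_algebra_le:
  fixes h :: "'a \<Rightarrow> real"
  assumes "\<mu> \<in> space (prob_algebra L)" "h \<in> borel_measurable L" "\<And>x. x \<in> space L \<Longrightarrow> \<bar>h x\<bar> \<le> B"
  shows "\<bar>\<integral>x. h x \<partial>\<mu>\<bar> \<le> B"
proof -
  have *: "prob_space \<mu>" "sets \<mu> = sets L"
    using assms(1) by (auto simp: space_prob_algebra)
  have "h \<in> borel_measurable \<mu>" "space \<mu> = space L"
    using assms measurable_cong_sets[OF *(2) refl, of borel] sets_eq_imp_space_eq[OF *(2)] by auto
  then show ?thesis
    using prob_space.integral_in_bounds[OF *(1), of h "- B" B] assms(3) by (fastforce simp: abs_le_iff)
qed

locale particle_system = particle_flow S \<eta>0 M G
  for S :: "nat \<Rightarrow> 'a measure" and \<eta>0 and M and G +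
  fixes N n :: nat and f :: "'a \<Rightarrow> real"
  assumes N: "N \<ge> 1" and f: "f \<in> Osc1 (S n)"
begin

abbreviation particles :: "nat \<Rightarrow> (nat \<Rightarrow> 'a) measure" where
  "particles k \<equiv> PiM {..<N} (\<lambda>_. S k)"

abbreviation law :: "nat \<Rightarrow> (nat \<Rightarrow> 'a) measure" where
  "law k \<equiv> plaw S \<eta>0 M G N k"

abbreviation mutation :: "nat \<Rightarrow> (nat \<Rightarrow> 'a) \<Rightarrow> nat \<Rightarrow> 'a measure" where
  "mutation k x i \<equiv> Kmu (G k) (M (Suc k)) (emp (S k) N x) (x i)"

abbreviation transition :: "nat \<Rightarrow> (nat \<Rightarrow> 'a) \<Rightarrow> (nat \<Rightarrow> 'a) measure" where
  "transition k x \<equiv> PiM {..<N} (mutation k x)"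

section \<open>The law of the particle configuration\<close>

lemma particles_component: "x \<in> space (particles k) \<Longrightarrow> i < N \<Longrightarrow> x i \<in> space (S k)"
  by (auto simp: space_PiM)

lemma sum_potential_pos:
  assumes "x \<in> space (particles k)"
  shows "0 < (\<Sum>i<N. G k (x i))"
  using N G_range particles_component[OF assms] by (intro sum_pos) (auto simp: lessThan_empty_iff)

lemma mutation_prob:
  assumes x: "x \<in> space (particles k)" and i: "i < N"
  shows "prob_space (mutation k x i)" "sets (mutation k x i) = sets (S (Suc k))"
    and integral_mutation: "\<And>h B. h \<in> borel_measurable (S (Suc k)) \<Longrightarrow> (\<And>y. y \<in> space (S (Suc k)) \<Longrightarrow> \<bar>h y\<bar> \<le> B) \<Longrightarrow>
      (\<integral>y. h y \<partial>mutation k x i) = G k (x i) * (\<integral>y. h y \<partial>M (Suc k) (x i))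
        + (1 - G k (x i)) * ((\<Sum>j<N. G k (x j) * (\<integral>y. h y \<partial>M (Suc k) (x j))) / (\<Sum>j<N. G k (x j)))"
proof -
  note xS = particles_component[OF x]
  have N0: "0 < N" using N by simp
  have emp: "prob_space (emp (S k) N x)" "sets (emp (S k) N x) = sets (S k)"
    using xS N0 by (auto intro!: prob_space_emp)
  show "prob_space (mutation k x i)" "sets (mutation k x i) = sets (S (Suc k))"
    using Kmu_kernel[OF emp G_meas G_range xS[OF i] kernels] by auto
  fix h :: "'a \<Rightarrow> real" and B
  assume h: "h \<in> borel_measurable (S (Suc k))" "\<And>y. y \<in> space (S (Suc k)) \<Longrightarrow> \<bar>h y\<bar> \<le> B"
  have "(\<integral>y. G k y * (\<integral>z. h z \<partial>M (Suc k) y) \<partial>emp (S k) N x)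
      = (\<Sum>j<N. G k (x j) * (\<integral>y. h y \<partial>M (Suc k) (x j))) / real N"
    using xS N0 G_meas kernel_integral_meas[OF h(1)] by (intro integral_emp) auto
  moreover have "(\<integral>y. G k y \<partial>emp (S k) N x) = (\<Sum>j<N. G k (x j)) / real N"
    using xS N0 G_meas by (intro integral_emp) auto
  ultimately show "(\<integral>y. h y \<partial>mutation k x i) = G k (x i) * (\<integral>y. h y \<partial>M (Suc k) (x i))
        + (1 - G k (x i)) * ((\<Sum>j<N. G k (x j) * (\<integral>y. h y \<partial>M (Suc k) (x j))) / (\<Sum>j<N. G k (x j)))"
    using integral_Kmu[OF emp G_meas G_range xS[OF i] kernels h] N0 by simp
qed

text \<open>The average of the mutation laws is the one-step flow applied to the empirical measure.\<close>
lemma sum_integral_mutation: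
  assumes x: "x \<in> space (particles k)" and h: "h \<in> borel_measurable (S (Suc k))"
    "\<And>y. y \<in> space (S (Suc k)) \<Longrightarrow> \<bar>h y\<bar> \<le> B"
  shows "(\<Sum>i<N. \<integral>y. h y \<partial>mutation k x i)
    = real N * (\<Sum>j<N. G k (x j) * (\<integral>y. h y \<partial>M (Suc k) (x j))) / (\<Sum>j<N. G k (x j))"
proof -
  define s where "s = (\<Sum>j<N. G k (x j))"
  define t where "t = (\<Sum>j<N. G k (x j) * (\<integral>y. h y \<partial>M (Suc k) (x j)))"
  have s: "0 < s" unfolding s_def by (rule sum_potential_pos[OF x])
  have "(\<Sum>i<N. \<integral>y. h y \<partial>mutation k x i)
      = (\<Sum>i<N. G k (x i) * (\<integral>y. h y \<partial>M (Suc k) (x i)) + (1 - G k (x i)) * (t / s))"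
    unfolding s_def t_def by (intro sum.cong refl integral_mutation[OF x _ h]) auto
  \<comment> \<open>Acceptance contributes \<open>t\<close>; the rejected mass \<open>N - s\<close>
    is resampled with mean \<open>t / s\<close>. The total \<open>N * t / s\<close> no longer shows
    the acceptance mechanism.\<close>
  also have "\<dots> = t + (real N - s) * (t / s)"
    unfolding sum.distrib sum_distrib_right[symmetric] sum_subtractf t_def[symmetric] s_def[symmetric] by simp
  also have "\<dots> = real N * t / s"
    using s by (simp add: field_simps)
  finally show ?thesis unfolding s_def t_def .
qed

text \<open>With an indicator as test function, the integral formula writes the probability of a set
  as an explicit expression in finitely many coordinates, which is visibly measurable.\<close>

lemma mutation_measurable:
  assumes i: "i < N"
  shows "(\<lambda>x. mutation k x i) \<in> particles k \<rightarrow>\<^sub>M prob_algebra (S (Suc k))"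
proof (rule measurable_prob_algebraI[OF mutation_prob(1)[OF _ i] measurable_subprob_algebra])
  fix A assume A: "A \<in> sets (S (Suc k))"
  define h where "h = (indicator A :: 'a \<Rightarrow> real)"
  have h: "h \<in> borel_measurable (S (Suc k))" "\<And>y. \<bar>h y\<bar> \<le> 1"
    using A by (auto simp: h_def indicator_def)
  have meas: "(\<lambda>x. g (x j)) \<in> borel_measurable (particles k)"
    if "g \<in> borel_measurable (S k)" "j < N" for g :: "'a \<Rightarrow> real" and j
  proof (rule measurable_compose[OF _ that(1)])
    show "(\<lambda>x. x j) \<in> particles k \<rightarrow>\<^sub>M S k"
      using measurable_component_singleton[of j "{..<N}" "\<lambda>_. S k"] that(2) by simp
  qed
  have "emeasure (mutation k x i) A = ennreal (G k (x i) * (\<integral>y. h y \<partial>M (Suc k) (x i))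
        + (1 - G k (x i)) * ((\<Sum>j<N. G k (x j) * (\<integral>y. h y \<partial>M (Suc k) (x j))) / (\<Sum>j<N. G k (x j))))"
    if x: "x \<in> space (particles k)" for x
  proof -
    interpret K: prob_space "mutation k x i" by (rule mutation_prob(1)[OF x i])
    have "emeasure (mutation k x i) A = ennreal (\<integral>y. h y \<partial>mutation k x i)"
      using A mutation_prob(2)[OF x i] by (simp add: h_def K.emeasure_eq_measure sets.Int_space_eq2)
    then show ?thesis
      using integral_mutation[OF x i h] by simp
  qed
  moreover have "(\<lambda>x. ennreal (G k (x i) * (\<integral>y. h y \<partial>M (Suc k) (x i))
        + (1 - G k (x i)) * ((\<Sum>j<N. G k (x j) * (\<integral>y. h y \<partial>M (Suc k) (x j))) / (\<Sum>j<N. G k (x j)))))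
      \<in> borel_measurable (particles k)"
    using i meas[OF G_meas] meas[OF kernel_integral_meas[OF h(1)]]
    by (intro measurable_compose[OF _ measurable_ennreal] borel_measurable_add borel_measurable_times
        borel_measurable_diff borel_measurable_divide borel_measurable_sum borel_measurable_const) auto
  ultimately show "(\<lambda>x. emeasure (mutation k x i) A) \<in> borel_measurable (particles k)"
    by (simp cong: measurable_cong)
qed (auto simp: mutation_prob(2)[OF _ i] intro: prob_space_imp_subprob_space mutation_prob(1) i)

lemma transition_measurable: "transition k \<in> particles k \<rightarrow>\<^sub>M prob_algebra (particles (Suc k))"
  using mutation_measurable by (intro PiM_kernel_measurable) auto

lemma law_prob: "law k \<in> space (prob_algebra (particles k))"
proof (induction k)
  case 0
  have "prob_space \<eta>0" "sets \<eta>0 = sets (S 0)"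
    using eta0 by (auto simp: space_prob_algebra)
  then show ?case
    by (auto simp: space_prob_algebra intro!: prob_space_PiM sets_PiM_cong)
next
  case (Suc k)
  from prob_space_bind'[OF this transition_measurable] sets_bind'[OF this transition_measurable]
  show ?case by (simp add: space_prob_algebra)
qed

text \<open>Conditioning on the configuration one step earlier; this is the only way in which the
  laws at different times are related.\<close>

lemma integral_law_Suc:
  fixes h :: "(nat \<Rightarrow> 'a) \<Rightarrow> real"
  assumes "h \<in> borel_measurable (particles (Suc k))" "\<And>y. y \<in> space (particles (Suc k)) \<Longrightarrow> \<bar>h y\<bar> \<le> B"
  shows "(\<integral>y. h y \<partial>law (Suc k)) = (\<integral>x. (\<integral>y. h y \<partial>transition k x) \<partial>law k)"
proof -
  have l: "prob_space (law k)" "sets (law k) = sets (particles k)"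
    using law_prob[of k] by (auto simp: space_prob_algebra)
  have "transition k \<in> law k \<rightarrow>\<^sub>M prob_algebra (particles (Suc k))"
    using transition_measurable[of k] measurable_cong_sets[OF l(2) refl] by auto
  from integral_bind_bounded[OF l(1) this assms] show ?thesis by simp
qed

text \<open>\<open>Phi p x\<close> is the value at \<open>f\<close> of the limiting flow run from time \<open>p\<close> to \<open>n\<close>, started from the
  empirical measure of the configuration \<open>x\<close>; it interpolates between \<open>eta_f\<close> and the particle average.\<close>
definition Phi :: "nat \<Rightarrow> (nat \<Rightarrow> 'a) \<Rightarrow> real" where
  "Phi p x = (\<Sum>i<N. Qk M G p (n - p) f (x i)) / (\<Sum>i<N. Qk M G p (n - p) (\<lambda>_. 1) (x i))"

abbreviation eta_f :: real where
  "eta_f \<equiv> (\<integral>y. f y \<partial>eta \<eta>0 M G n)"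

lemma f_bounded: obtains B where "\<And>y. y \<in> space (S n) \<Longrightarrow> \<bar>f y\<bar> \<le> B"
proof -
  obtain l where l: "\<And>x. x \<in> space (S n) \<Longrightarrow> l \<le> f x" "\<And>x. x \<in> space (S n) \<Longrightarrow> f x \<le> l + 2"
    using Osc1_bounds[OF f] by blast
  show ?thesis
  proof (rule that[of "\<bar>l\<bar> + 2"])
    fix y assume "y \<in> space (S n)"
    from l[OF this] show "\<bar>f y\<bar> \<le> \<bar>l\<bar> + 2" by linarith
  qed
qed

lemma Q_meas:
  assumes "p \<le> n"
  shows "Qk M G p (n - p) f \<in> borel_measurable (S p)" "Qk M G p (n - p) (\<lambda>_. 1) \<in> borel_measurable (S p)"
  using f assms by (auto intro!: Qk_meas simp: Osc1_def)

lemma Phi_measurable: "p \<le> n \<Longrightarrow> Phi p \<in> borel_measurable (particles p)"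
  unfolding Phi_def using Q_meas[of p] by measurable

lemma Phi_bounded:
  assumes "p \<le> n" "x \<in> space (particles p)" and B: "\<And>y. y \<in> space (S n) \<Longrightarrow> \<bar>f y\<bar> \<le> B"
  shows "\<bar>Phi p x\<bar> \<le> B"
proof -
  let ?W = "\<Sum>i<N. Qk M G p (n - p) (\<lambda>_. 1) (x i)"
  have W: "0 < ?W"
    using N Qk_one_pos particles_component[OF assms(2)] by (intro sum_pos) (auto simp: lessThan_empty_iff)
  have "\<bar>\<Sum>i<N. Qk M G p (n - p) f (x i)\<bar> \<le> (\<Sum>i<N. \<bar>Qk M G p (n - p) f (x i)\<bar>)"
    by (rule sum_abs)
  also have "\<dots> \<le> (\<Sum>i<N. B * Qk M G p (n - p) (\<lambda>_. 1) (x i))"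
  proof (intro sum_mono)
    fix i assume "i \<in> {..<N}"
    then have xi: "x i \<in> space (S p)" using particles_component[OF assms(2)] by simp
    have "- B * Qk M G p (n - p) (\<lambda>_. 1) (x i) \<le> Qk M G p (n - p) f (x i)
      \<and> Qk M G p (n - p) f (x i) \<le> B * Qk M G p (n - p) (\<lambda>_. 1) (x i)"
    proof (rule Qk_sandwich[OF _ _ _ xi])
      show "f \<in> borel_measurable (S (p + (n - p)))" using f assms(1) by (simp add: Osc1_def)
      fix y assume "y \<in> space (S (p + (n - p)))"
      then have "\<bar>f y\<bar> \<le> B" using B assms(1) by simp
      then show "- B \<le> f y" "f y \<le> B" by auto
    qed
    then show "\<bar>Qk M G p (n - p) f (x i)\<bar> \<le> B * Qk M G p (n - p) (\<lambda>_. 1) (x i)" by auto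
  qed
  also have "\<dots> = B * ?W" by (simp add: sum_distrib_left)
  finally show ?thesis
    using W by (simp add: Phi_def pos_divide_le_eq)
qed

text \<open>Half of the corresponding summand of \<open>sigma1\<close>.\<close>

abbreviation bias_term :: "nat \<Rightarrow> real" where
  "bias_term p \<equiv> 2 * qpn S M G p n ^ 3 * beta S M G p n"

abbreviation moment_term :: "nat \<Rightarrow> nat \<Rightarrow> real" where
  "moment_term k p \<equiv> bconst (2 * k) ^ 2 * bias_term p / real N
     + bconst k * (2 * qpn S M G p n * beta S M G p n) / sqrt (real N)"

lemma qpn_beta_nonneg:
  assumes "p \<le> n"
  shows "0 \<le> qpn S M G p n" "0 \<le> beta S M G p n"
proof -
  obtain x where x: "x \<in> space (S p)" using space_nonempty by blast
  have "0 < qpn S M G p n * Qk M G p (n - p) (\<lambda>_. 1) x"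
    using Qk_one_ratio[OF x x, of n] Qk_one_pos[OF x, of "n - p"] by linarith
  then show "0 \<le> qpn S M G p n"
    using Qk_one_pos[OF x, of "n - p"] by (simp add: zero_less_mult_iff)
  show "0 \<le> beta S M G p n"
    using P_diff_le_beta[OF f assms x x] by simp
qed

text \<open>One statement for both kinds of step: \<open>K\<close> is the constant family
  \<open>\<eta>0\<close> at time 0 and the mutation laws afterwards, with \<open>r\<close> the ratio
  of averaged means. The last claim serves for integrability in the moment estimate.\<close>

lemma local_error:
  assumes p: "p \<le> n" and K_all: "\<forall>i<N. prob_space (K i) \<and> sets (K i) = sets (S p)"
    and r: "r = (\<Sum>i<N. \<integral>y. Qk M G p (n - p) f y \<partial>K i) / (\<Sum>i<N. \<integral>y. Qk M G p (n - p) (\<lambda>_. 1) y \<partial>K i)"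
  shows "\<bar>(\<integral>x. Phi p x \<partial>PiM {..<N} K) - r\<bar> \<le> bias_term p / real N"
    and "(\<integral>x. \<bar>Phi p x - r\<bar> ^ k \<partial>PiM {..<N} K) \<le> moment_term k p ^ k"
    and "\<And>x. x \<in> space (particles p) \<Longrightarrow> \<bar>Phi p x - r\<bar> \<le> beta S M G p n"
proof -
  have K: "prob_space (K i)" "sets (K i) = sets (S p)" if "i < N" for i
    using K_all that by auto
  \<comment> \<open>Indices from \<open>N\<close> on receive the law \<open>K 0\<close>, so that
    every index carries a probability measure.\<close>
  define K' where "K' i = (if i < N then K i else K 0)" for i
  have N0: "0 < N" using N by simp
  have K': "prob_space (K' i)" "sets (K' i) = sets (S p)" for i
    using K N0 by (auto simp: K'_def)
  interpret product_prob_space K' "{..<N}"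
    by (rule product_prob_spaceI[OF K'(1)])
  have KK': "PiM {..<N} K = PiM {..<N} K'"
    by (intro PiM_cong) (auto simp: K'_def)
  have sums: "(\<Sum>i<N. \<integral>y. h y \<partial>K i) = (\<Sum>i<N. \<integral>y. h y \<partial>K' i)" for h :: "'a \<Rightarrow> real"
    by (intro sum.cong) (auto simp: K'_def)
  have J: "finite {..<N}" "{..<N} \<noteq> {}" using N0 by (auto simp: lessThan_empty_iff)
  have P: "\<bar>Qk M G p (n - p) f x / Qk M G p (n - p) (\<lambda>_. 1) x - Qk M G p (n - p) f y / Qk M G p (n - p) (\<lambda>_. 1) y\<bar>
      \<le> beta S M G p n" if "x \<in> space (S p)" "y \<in> space (S p)" for x y
    using P_diff_le_beta[OF f p that] by (simp add: P_def Q_def)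
  note err = ratio_average_error[OF J K'(2) Q_meas[OF p] Qk_one_pos Qk_one_ratio P,
      folded sums, folded r Phi_def, unfolded KK'[symmetric] card_lessThan]
  have sets_K: "sets (PiM {..<N} K) = sets (particles p)"
    by (intro sets_PiM_cong K) auto
  have PK: "PiM {..<N} K \<in> space (prob_algebra (particles p))"
    using sets_K K by (auto simp: space_prob_algebra intro!: prob_space_PiM)
  obtain B where B: "\<And>y. y \<in> space (S n) \<Longrightarrow> \<bar>f y\<bar> \<le> B" using f_bounded by blast
  interpret pk: prob_space "PiM {..<N} K"
    using PK by (simp add: space_prob_algebra)
  have "integrable (PiM {..<N} K) (Phi p)"
    by (rule integrable_prob_algebra[OF PK Phi_measurable[OF p] Phi_bounded[OF p _ B]])
  then have "(\<integral>x. Phi p x - r \<partial>PiM {..<N} K) = (\<integral>x. Phi p x \<partial>PiM {..<N} K) - r"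
    using pk.prob_space by simp
  then show "\<bar>(\<integral>x. Phi p x \<partial>PiM {..<N} K) - r\<bar> \<le> bias_term p / real N"
    using err(1) by simp
  show "(\<integral>x. \<bar>Phi p x - r\<bar> ^ k \<partial>PiM {..<N} K) \<le> moment_term k p ^ k"
    by (rule err(2))
  show "\<bar>Phi p x - r\<bar> \<le> beta S M G p n" if "x \<in> space (particles p)" for x
    using err(3)[of x] that sets_eq_imp_space_eq[OF sets_K] by simp
qed

lemma mutation_all: "x \<in> space (particles k) \<Longrightarrow> \<forall>i<N. prob_space (mutation k x i) \<and> sets (mutation k x i) = sets (S (Suc k))"
  using mutation_prob(1,2) by blast

text \<open>The centre of the next step is the present value of \<open>Phi\<close>: after averaging
  the mutation laws, the common factor \<open>N\<close> over the sum of potentials cancels in the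
  ratio, and one application of \<open>G\<close> and \<open>M\<close> extends the semigroup back to
  time \<open>p\<close>.\<close>

lemma transition_ratio:
  assumes p: "Suc p \<le> n" and x: "x \<in> space (particles p)"
  shows "Phi p x = (\<Sum>i<N. \<integral>y. Qk M G (Suc p) (n - Suc p) f y \<partial>mutation p x i)
    / (\<Sum>i<N. \<integral>y. Qk M G (Suc p) (n - Suc p) (\<lambda>_. 1) y \<partial>mutation p x i)"
proof -
  have nn: "n - p = Suc (n - Suc p)" using p by simp
  obtain B where B: "\<And>y. y \<in> space (S n) \<Longrightarrow> \<bar>f y\<bar> \<le> B" using f_bounded by blast
  have "\<bar>Qk M G (Suc p) (n - Suc p) f y\<bar> \<le> B" if "y \<in> space (S (Suc p))" for y
    using f B p that by (intro Qk_abs_le) (auto simp: Osc1_def)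
  then have 1: "(\<Sum>i<N. \<integral>y. Qk M G (Suc p) (n - Suc p) f y \<partial>mutation p x i)
    = real N * (\<Sum>j<N. G p (x j) * (\<integral>y. Qk M G (Suc p) (n - Suc p) f y \<partial>M (Suc p) (x j))) / (\<Sum>j<N. G p (x j))"
    by (rule sum_integral_mutation[OF x Q_meas(1)[OF p]])
  have "\<bar>Qk M G (Suc p) (n - Suc p) (\<lambda>_. 1) y\<bar> \<le> 1" if "y \<in> space (S (Suc p))" for y
    using that by (intro Qk_abs_le) auto
  then have 2: "(\<Sum>i<N. \<integral>y. Qk M G (Suc p) (n - Suc p) (\<lambda>_. 1) y \<partial>mutation p x i)
    = real N * (\<Sum>j<N. G p (x j) * (\<integral>y. Qk M G (Suc p) (n - Suc p) (\<lambda>_. 1) y \<partial>M (Suc p) (x j))) / (\<Sum>j<N. G p (x j))"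
    by (rule sum_integral_mutation[OF x Q_meas(2)[OF p]])
  show ?thesis
    unfolding 1 2 Phi_def nn Qk.simps using sum_potential_pos[OF x] N by simp
qed

section \<open>Accumulation of the local errors over time\<close>

lemma bias_le: "p \<le> n \<Longrightarrow> \<bar>(\<integral>x. Phi p x \<partial>law p) - eta_f\<bar> \<le> (\<Sum>r\<le>p. bias_term r) / real N"
proof (induction p)
  case 0
  have \<eta>0: "prob_space \<eta>0" "sets \<eta>0 = sets (S 0)"
    using eta0 by (auto simp: space_prob_algebra)
  obtain B where B: "\<And>y. y \<in> space (S n) \<Longrightarrow> \<bar>f y\<bar> \<le> B" using f_bounded by blast
  have "eta_f = (\<integral>y. Qk M G 0 (n - 0) f y \<partial>\<eta>0) / (\<integral>y. Qk M G 0 (n - 0) (\<lambda>_. 1) y \<partial>\<eta>0)"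
    using eta_semigroup[of 0 n f B] f B by (simp add: Osc1_def)
  then show ?case
    using local_error(1)[of 0 "\<lambda>_. \<eta>0" eta_f] \<eta>0 N by simp
next
  case (Suc p)
  obtain B where B: "\<And>y. y \<in> space (S n) \<Longrightarrow> \<bar>f y\<bar> \<le> B" using f_bounded by blast
  let ?W = "\<lambda>x. \<integral>y. Phi (Suc p) y \<partial>transition p x"
  have p: "p \<le> n" using Suc by simp
  have W_le: "\<bar>?W x - Phi p x\<bar> \<le> bias_term (Suc p) / real N" if x: "x \<in> space (particles p)" for x
    using local_error(1)[OF Suc.prems mutation_all[OF x] transition_ratio[OF Suc.prems x]] by simp
  have W_meas: "?W \<in> borel_measurable (particles p)"
    by (rule measurable_compose[OF measurable_prob_algebraD[OF transition_measurable]
          integral_measurable_subprob_algebra[OF Phi_measurable[OF Suc.prems]]])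
  have W_bounded: "\<bar>?W x\<bar> \<le> B" if x: "x \<in> space (particles p)" for x
    by (rule abs_integral_prob_algebra_le[OF measurable_space[OF transition_measurable x]
          Phi_measurable[OF Suc.prems] Phi_bounded[OF Suc.prems _ B]])
  have "(\<integral>x. Phi (Suc p) x \<partial>law (Suc p)) - eta_f = (\<integral>x. ?W x \<partial>law p) - eta_f"
    using integral_law_Suc[OF Phi_measurable[OF Suc.prems] Phi_bounded[OF Suc.prems _ B]] by simp
  also have "(\<integral>x. ?W x \<partial>law p) - eta_f = (\<integral>x. ?W x - Phi p x \<partial>law p) + ((\<integral>x. Phi p x \<partial>law p) - eta_f)"
    \<comment> \<open>Splitting the integral requires both parts to be integrable under
      \<open>law p\<close>; both are bounded by \<open>B\<close>.\<close>
    using integrable_prob_algebra[OF law_prob W_meas W_bounded]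
      integrable_prob_algebra[OF law_prob Phi_measurable[OF p] Phi_bounded[OF p _ B]] by simp
  finally have "\<bar>(\<integral>x. Phi (Suc p) x \<partial>law (Suc p)) - eta_f\<bar>
      \<le> \<bar>\<integral>x. ?W x - Phi p x \<partial>law p\<bar> + \<bar>(\<integral>x. Phi p x \<partial>law p) - eta_f\<bar>"
    by (simp only: abs_triangle_ineq)
  also have "\<dots> \<le> bias_term (Suc p) / real N + (\<Sum>r\<le>p. bias_term r) / real N"
  proof (rule add_mono[OF _ Suc.IH[OF p]])
    show "\<bar>\<integral>x. ?W x - Phi p x \<partial>law p\<bar> \<le> bias_term (Suc p) / real N"
    proof (rule abs_integral_prob_algebra_le[OF law_prob])
      show "(\<lambda>x. ?W x - Phi p x) \<in> borel_measurable (particles p)"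
        using W_meas Phi_measurable[OF p] by (rule borel_measurable_diff)
    qed (rule W_le)
  qed
  finally show ?case by (simp add: add_divide_distrib add.commute)
qed

lemma moment_le: "p \<le> n \<Longrightarrow> (\<integral>x. \<bar>Phi p x - eta_f\<bar> ^ k \<partial>law p) \<le> (\<Sum>r\<le>p. moment_term k r) ^ k"
proof (induction p)
  case 0
  have \<eta>0: "prob_space \<eta>0" "sets \<eta>0 = sets (S 0)"
    using eta0 by (auto simp: space_prob_algebra)
  obtain B where B: "\<And>y. y \<in> space (S n) \<Longrightarrow> \<bar>f y\<bar> \<le> B" using f_bounded by blast
  have "eta_f = (\<integral>y. Qk M G 0 (n - 0) f y \<partial>\<eta>0) / (\<integral>y. Qk M G 0 (n - 0) (\<lambda>_. 1) y \<partial>\<eta>0)"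
    using eta_semigroup[of 0 n f B] f B by (simp add: Osc1_def)
  then show ?case
    using local_error(2)[of 0 "\<lambda>_. \<eta>0" eta_f k] \<eta>0 N by simp
next
  case (Suc p)
  obtain B where B: "\<And>y. y \<in> space (S n) \<Longrightarrow> \<bar>f y\<bar> \<le> B" using f_bounded by blast
  let ?F = "\<lambda>q x. \<bar>Phi q x - eta_f\<bar> ^ k"
  let ?a = "moment_term k (Suc p)"
  have p: "p \<le> n" using Suc by simp
  have a: "0 \<le> moment_term k r" if "r \<le> n" for r
    using qpn_beta_nonneg[OF that] bconst_nonneg[of k]
    by (intro add_nonneg_nonneg divide_nonneg_nonneg mult_nonneg_nonneg) auto
  have F_meas: "?F q \<in> borel_measurable (particles q)" if "q \<le> n" for q
    using Phi_measurable[OF that] by measurable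
  have V_c: "\<bar>Phi q x - eta_f\<bar> \<le> B + \<bar>eta_f\<bar>" if "q \<le> n" "x \<in> space (particles q)" for q x
    using Phi_bounded[OF that B] by linarith
  have F_le: "\<bar>?F q x\<bar> \<le> (B + \<bar>eta_f\<bar>) ^ k" if "q \<le> n" "x \<in> space (particles q)" for q x
    using power_mono[OF V_c[OF that], of k] by simp
  have inner: "(\<integral>y. ?F (Suc p) y \<partial>transition p x) \<le> (?a + \<bar>Phi p x - eta_f\<bar>) ^ k" if x: "x \<in> space (particles p)" for x
  proof -
    have t: "transition p x \<in> space (prob_algebra (particles (Suc p)))"
      by (rule measurable_space[OF transition_measurable x])
    then interpret T: prob_space "transition p x" by (simp add: space_prob_algebra)
    note le = local_error[OF Suc.prems mutation_all[OF x] transition_ratio[OF Suc.prems x]]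
    have "integrable (transition p x) (\<lambda>y. \<bar>Phi (Suc p) y - Phi p x\<bar> ^ k)"
      using Phi_measurable[OF Suc.prems] le(3)
      by (intro integrable_prob_algebra[OF t, of _ "beta S M G (Suc p) n ^ k"]) (auto intro!: power_mono)
    \<comment> \<open>Minkowski under \<open>transition p x\<close>, where the error accumulated up
      to time \<open>p\<close> is a constant and so enters with its own absolute value as
      bound.\<close>
    then have "(\<integral>y. \<bar>(Phi (Suc p) y - Phi p x) + (Phi p x - eta_f)\<bar> ^ k \<partial>transition p x) \<le> (?a + \<bar>Phi p x - eta_f\<bar>) ^ k"
      using le(2)[of k] a[OF Suc.prems] T.prob_space by (intro integral_abs_add_power_le) auto
    then show ?thesis by simp
  qed
  have "(\<integral>x. ?F (Suc p) x \<partial>law (Suc p)) = (\<integral>x. (\<integral>y. ?F (Suc p) y \<partial>transition p x) \<partial>law p)"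
    by (rule integral_law_Suc[OF F_meas[OF Suc.prems] F_le[OF Suc.prems]])
  also have "\<dots> \<le> (\<integral>x. \<bar>?a + \<bar>Phi p x - eta_f\<bar>\<bar> ^ k \<partial>law p)"
  proof (rule integral_mono')
    show "integrable (law p) (\<lambda>x. \<bar>?a + \<bar>Phi p x - eta_f\<bar>\<bar> ^ k)"
    proof (rule integrable_prob_algebra[OF law_prob])
      show "(\<lambda>x. \<bar>?a + \<bar>Phi p x - eta_f\<bar>\<bar> ^ k) \<in> borel_measurable (particles p)"
        using Phi_measurable[OF p] by measurable
      show "\<bar>\<bar>?a + \<bar>Phi p x - eta_f\<bar>\<bar> ^ k\<bar> \<le> (?a + (B + \<bar>eta_f\<bar>)) ^ k" if "x \<in> space (particles p)" for x
        unfolding abs_power_minus power_abs abs_abs using V_c[OF p that] a[OF Suc.prems]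
        by (intro power_mono) auto
    qed
    show "(\<integral>y. ?F (Suc p) y \<partial>transition p x) \<le> \<bar>?a + \<bar>Phi p x - eta_f\<bar>\<bar> ^ k" if "x \<in> space (law p)" for x
    proof -
      have "x \<in> space (particles p)"
        using that law_prob[of p] sets_eq_imp_space_eq[of "law p" "particles p"] by (simp add: space_prob_algebra)
      from inner[OF this] show ?thesis using a[OF Suc.prems] by simp
    qed
  qed simp
  \<comment> \<open>Minkowski under \<open>law p\<close>, now with \<open>?a\<close> as the
    constant: the local bound does not depend on the configuration.\<close>
  also have "\<dots> \<le> (?a + (\<Sum>r\<le>p. moment_term k r)) ^ k"
  proof (rule integral_abs_add_power_le)
    have pr: "prob_space (law p)" using law_prob[of p] by (simp add: space_prob_algebra)
    show "integrable (law p) (\<lambda>x. \<bar>?a\<bar> ^ k)"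
      by (rule finite_measure.integrable_const[OF prob_space.finite_measure[OF pr]])
    show "(\<integral>x. \<bar>?a\<bar> ^ k \<partial>law p) \<le> ?a ^ k"
      using a[OF Suc.prems] by (simp add: prob_space.prob_space[OF pr])
    show "integrable (law p) (\<lambda>x. \<bar>\<bar>Phi p x - eta_f\<bar>\<bar> ^ k)"
      using integrable_prob_algebra[OF law_prob F_meas[OF p] F_le[OF p]] by simp
    show "(\<integral>x. \<bar>\<bar>Phi p x - eta_f\<bar>\<bar> ^ k \<partial>law p) \<le> (\<Sum>r\<le>p. moment_term k r) ^ k"
      using Suc.IH[OF p] by simp
    show "0 \<le> ?a" by (rule a[OF Suc.prems])
    show "0 \<le> (\<Sum>r\<le>p. moment_term k r)" using a p by (intro sum_nonneg) auto
  qed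
  finally show ?case by (simp add: add.commute)
qed

section \<open>Evaluation at time \<open>n\<close> and rescaling by \<open>N\<close>\<close>

lemma Phi_final: "Phi n x = (\<Sum>i<N. f (x i)) / real N"
  by (simp add: Phi_def)

lemma bias_bound:
  "real N * \<bar>(\<integral>x. (\<Sum>i<N. f (x i)) / real N \<partial>law n) - eta_f\<bar> \<le> sigma1 S M G n"
proof -
  have "\<bar>(\<integral>x. (\<Sum>i<N. f (x i)) / real N \<partial>law n) - eta_f\<bar> \<le> (\<Sum>r\<le>n. bias_term r) / real N"
    using bias_le[OF order_refl] unfolding Phi_final .
  then have "real N * \<bar>(\<integral>x. (\<Sum>i<N. f (x i)) / real N \<partial>law n) - eta_f\<bar> \<le> (\<Sum>r\<le>n. bias_term r)"
    using N by (simp add: field_simps)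
  also have "\<dots> \<le> (\<Sum>r\<le>n. 4 * (qpn S M G r n ^ 3 * beta S M G r n))"
    using qpn_beta_nonneg by (intro sum_mono) auto
  finally show ?thesis by (simp add: sigma1_def sum_distrib_left)
qed

lemma moment_bound:
  assumes "m \<ge> 1"
  shows "sqrt (real N) * (\<integral>x. \<bar>(\<Sum>i<N. f (x i)) / real N - eta_f\<bar> ^ m \<partial>law n) powr (1 / real m)
    \<le> 1 / sqrt (real N) * bconst (2 * m) ^ 2 * sigma1 S M G n + bconst m * sigma2 S M G n"
proof -
  let ?I = "\<integral>x. \<bar>(\<Sum>i<N. f (x i)) / real N - eta_f\<bar> ^ m \<partial>law n"
  let ?A = "\<Sum>r\<le>n. moment_term m r"
  have A: "0 \<le> ?A"
    using qpn_beta_nonneg bconst_nonneg[of m]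
    by (intro sum_nonneg add_nonneg_nonneg divide_nonneg_nonneg mult_nonneg_nonneg) auto
  have "?I \<le> ?A ^ m"
    using moment_le[OF order_refl, of m] unfolding Phi_final .
  moreover have "0 \<le> ?I" by simp
  ultimately have "?I powr (1 / real m) \<le> (?A ^ m) powr (1 / real m)"
    by (intro powr_mono2) auto
  also have "\<dots> = ?A"
  \<comment> \<open>Power and root are inverse through \<open>powr\<close> only for a positive base;
    zero is treated separately.\<close>
  proof (cases "?A = 0")
    case False
    with A have "0 < ?A" by simp
    then show ?thesis
      using assms by (simp add: powr_powr flip: powr_realpow)
  qed (use assms in simp)
  finally have "sqrt (real N) * ?I powr (1 / real m) \<le> sqrt (real N) * ?A"
    by (rule mult_left_mono) simp
  also have "\<dots> = (\<Sum>r\<le>n. 1 / sqrt (real N) * bconst (2 * m) ^ 2 * bias_term r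
      + bconst m * (2 * qpn S M G r n * beta S M G r n))"
    unfolding sum_distrib_left
  proof (intro sum.cong refl)
    fix r
    have "sqrt (real N) * (X / real N + Y / sqrt (real N)) = 1 / sqrt (real N) * X + Y" for X Y
      using N real_div_sqrt[of "real N"] by (simp add: field_simps)
    from this[of "bconst (2 * m) ^ 2 * bias_term r" "bconst m * (2 * qpn S M G r n * beta S M G r n)"]
    show "sqrt (real N) * moment_term m r = 1 / sqrt (real N) * bconst (2 * m) ^ 2 * bias_term r
        + bconst m * (2 * qpn S M G r n * beta S M G r n)"
      by (simp only: mult.assoc)
  qed
  \<comment> \<open>The factor 2 obtained in the bias part is relaxed to the 4 of
    \<open>sigma1\<close>; the \<open>sigma2\<close> part is already exact.\<close>
  also have "\<dots> \<le> (\<Sum>r\<le>n. 1 / sqrt (real N) * bconst (2 * m) ^ 2 * (4 * (qpn S M G r n ^ 3 * beta S M G r n))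
      + bconst m * (2 * (qpn S M G r n * beta S M G r n)))"
    using qpn_beta_nonneg bconst_nonneg[of m]
    by (intro sum_mono add_mono mult_left_mono) auto
  also have "\<dots> = 1 / sqrt (real N) * bconst (2 * m) ^ 2 * sigma1 S M G n + bconst m * sigma2 S M G n"
    unfolding sigma1_def sigma2_def sum.distrib sum_distrib_left ..
  finally show ?thesis .
qed

end

theorem theorem4p4:
  fixes S :: "nat \<Rightarrow> 'a measure"
    and \<eta>0 :: "'a measure"
    and M :: "nat \<Rightarrow> 'a \<Rightarrow> 'a measure"
    and G :: "nat \<Rightarrow> 'a \<Rightarrow> real"
    and n N :: nat
    and f :: "'a \<Rightarrow> real"
  assumes eta0: "\<eta>0 \<in> space (prob_algebra (S 0))"
    and kernels: "\<And>k. M (Suc k) \<in> S k \<rightarrow>\<^sub>M prob_algebra (S (Suc k))"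
    and G_meas: "\<And>k. G k \<in> borel_measurable (S k)"
    and G_range: "\<And>k x. x \<in> space (S k) \<Longrightarrow> 0 < G k x \<and> G k x < 1"
    and G_ratio: "\<And>k. \<exists>c. \<forall>x\<in>space (S k). \<forall>y\<in>space (S k). G k x / G k y \<le> c"
    and f: "f \<in> Osc1 (S n)"
    and N: "N \<ge> 1"
  shows "real N * \<bar>(\<integral>x. (\<Sum>i<N. f (x i)) / real N \<partial>plaw S \<eta>0 M G N n)
                    - (\<integral>y. f y \<partial>eta \<eta>0 M G n)\<bar> \<le> sigma1 S M G n
       \<and> (\<forall>m::nat. m \<ge> 1 \<longrightarrow>
            sqrt (real N) *
              (\<integral>x. \<bar>(\<Sum>i<N. f (x i)) / real N - (\<integral>y. f y \<partial>eta \<eta>0 M G n)\<bar> ^ m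
                 \<partial>plaw S \<eta>0 M G N n) powr (1 / real m)
            \<le> 1 / sqrt (real N) * bconst (2 * m) ^ 2 * sigma1 S M G n
              + bconst m * sigma2 S M G n)"
proof -
  interpret particle_system S \<eta>0 M G N n f
    by unfold_locales (fact assms)+
  show ?thesis
    using bias_bound moment_bound by blast
qed

end
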